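(* For any $m\in(0,1)\cup(1,+\infty)$ the function $p\mapsto g_2(p,m)$ has a minimal positive root $p_2(m)$, and the function $p_2$ satisfies the following properties. (a) $p_2(m)$ is continuous for $m\in(0,1)$ and coincides with $\frac{\pi m}{1-m}$ at the points $\{m=\frac{k}{k+1}\mid k\in\mathbb{N}\}$ and, for each $k\in\mathbb{N}$, at some point $m=m^{*}_{1,k}$ with $$\frac{1+2k}{3+2k}-\frac{2}{15+40k+32k^2+8k^3}<m^{*}_{1,k}<\frac{1+2k}{3+2k};$$ $p_2(m)$ is continuous for $m\in(1,+\infty)$ and coincides with $\frac{\pi m}{m-1}$ at the points $\{m=\frac{k+1}{k}\mid k\in\mathbb{N}\}$ and, for each $k\in\mathbb{N}$, at some point $m=m^{*}_{2,k}$ with $$\frac{3+2k}{1+2k}<m^{*}_{2,k}<\frac{3+2k}{1+2k}+\frac{2}{1+8k(1+k^2)}.$$ (b) $p_2(m)$ is continuously differentiable at all points of the set $(0,\frac12)\cup(2,+\infty)$ and of the sets $$\left[\frac{k}{1+k},\frac{1+2k}{3+2k}-\frac{2}{15+40k+32k^2+8k^3}\right]\cup\left[\frac{1+2k}{3+2k},\frac{1+k}{2+k}\right]\cup\left[\frac{k+2}{k+1},\frac{3+2k}{1+2k}\right]\cup\left[\frac{3+2k}{1+2k}+\frac{2}{1+8k(1+k^2)},\frac{k+1}{k}\right]$$ for all $k\in\mathbb{N}$. Outside these sets there exist, for each $k\in\mathbb{N}$, values $m=\bar m_{1,k}$ and $m=\bar m_{2,k}$ with $$\frac{1+2k}{3+2k}-\frac{2}{15+40k+32k^2+8k^3}<m^{*}_{1,k}<\bar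 m_{1,k}<\frac{1+2k}{3+2k},$$ $$\frac{3+2k}{1+2k}<\bar m_{2,k}<m^{*}_{2,k}<\frac{3+2k}{1+2k}+\frac{2}{1+8k(1+k^2)},$$ at which the derivative $p_2'(m)$ is equal to $+\infty$ (at $\bar m_{1,k}$) and to $-\infty$ (at $\bar m_{2,k}$). (c) For $m\in(0,1)$: $$5.7\,m<p_2(m)<2\pi m\ \text{ for } m<\tfrac12,$$ $$\frac{\pi m}{1-m}-\frac{m}{1-m}\arcsin\left(\frac{1-m}{1+m}\right)<p_2(m)<\frac{\pi m}{1-m}+\frac{m}{3m-1}\ \text{ for } m\ge\tfrac12.$$ For $m>1$: $$\frac{\pi m}{m-1}-\frac{m}{m-1}\arcsin\left(\frac{m-1}{m+1}\right)<p_2(m)<\frac{\pi m}{m-1}+\frac{m}{3-m}\ \text{ for } m\le2,$$ $$5.7<p_2(m)<2\pi\ \text{ for } m>2.$$ (d) For every $k\in\mathbb{N}$: $$p_2(m)<\frac{\pi m}{1-m}\ \text{ for } m\in\left(\frac{k}{1+k},\frac{1+2k}{3+2k}-\frac{2}{15+40k+32k^2+8k^3}\right],$$ $$p_2(m)>\frac{\pi m}{1-m}\ \text{ for } m\in\left[\frac{1+2k}{3+2k},\frac{1+k}{2+k}\right),$$ $$p_2(m)>\frac{\pi m}{m-1}\ \text{ for } m\in\left(\frac{k+2}{k+1},\frac{3+2k}{1+2k}\right],$$ $$p_2(m)<\frac{\pi m}{m-1}\ \text{ for } m\in\left[\frac{3+2k}{1+2k}+\frac{2}{1+8k(1+k^2)},\frac{k+1}{k}\right).$$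 (e) At the point $p=p_2(m)$ the function $p\mapsto g_2(p,m)$ changes its sign.
   Context: $\mathbb{N}=\{1,2,3,\dots\}$. For $m\in(0,1)\cup(1,+\infty)$ and $p>0$, $$g_2(p,m)=m\,p\cos\left(\frac pm\right)\sin p-\bigl(p\cos p+(m^2-1)\sin p\bigr)\sin\left(\frac pm\right),$$ and $$p_2(m)=\min\{p>0\mid g_2(p,m)=0\}.$$ A derivative equal to $\pm\infty$ at a point means that the limit of the difference quotient at that point is $\pm\infty$. *)

theory Defs
  imports "HOL-Analysis.Analysis"
begin

definition g2 :: "real \<Rightarrow> real \<Rightarrow> real" where
  "g2 p m = m * p * cos (p / m) * sin p - (p * cos p + (m\<^sup>2 - 1) * sin p) * sin (p / m)"

text \<open>The minimum of the set of positive roots. It is an unspecified real number if that set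
  has no least element.\<close>

definition p2 :: "real \<Rightarrow> real" where
  "p2 m = (LEAST p. p > 0 \<and> g2 p m = 0)"

text \<open>The bounds \<open>lo1 k < m < hi1 k\<close> (for \<open>m < 1\<close>) and \<open>lo2 k < m < hi2 k\<close> (for \<open>m > 1\<close>)
  delimit the gaps between the intervals on which \<open>p2\<close> is asserted to be \<open>C\<^sup>1\<close>.\<close>

definition hi1 :: "nat \<Rightarrow> real" where
  "hi1 k = (1 + 2 * real k) / (3 + 2 * real k)"

definition lo1 :: "nat \<Rightarrow> real" where
  "lo1 k = (1 + 2 * real k) / (3 + 2 * real k)
           - 2 / (15 + 40 * real k + 32 * real k ^ 2 + 8 * real k ^ 3)"

definition lo2 :: "nat \<Rightarrow> real" where
  "lo2 k = (3 + 2 * real k) / (1 + 2 * real k)"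

definition hi2 :: "nat \<Rightarrow> real" where
  "hi2 k = (3 + 2 * real k) / (1 + 2 * real k) + 2 / (1 + 8 * real k * (1 + real k ^ 2))"

definition smooth_set :: "real set" where
  "smooth_set = {0<..<1/2} \<union> {2<..} \<union>
     (\<Union>k\<in>{1::nat..}.
        {real k / (1 + real k) .. lo1 k} \<union>
        {hi1 k .. (1 + real k) / (2 + real k)} \<union>
        {(real k + 2) / (real k + 1) .. lo2 k} \<union>
        {hi2 k .. (real k + 1) / real k})"

text \<open>Continuous differentiability at a point is two-sided and means being \<open>C\<^sup>1\<close> on a
  neighbourhood, also at the end points of the closed intervals above.\<close>

definition C1_at :: "(real \<Rightarrow> real) \<Rightarrow> real \<Rightarrow> bool" where
  "C1_at f x \<longleftrightarrow> (\<exists>U. open U \<and> x \<in> U \<and> f C1_differentiable_on U)"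

definition has_deriv_pinfty :: "(real \<Rightarrow> real) \<Rightarrow> real \<Rightarrow> bool" where
  "has_deriv_pinfty f x \<longleftrightarrow> filterlim (\<lambda>h. (f (x + h) - f x) / h) at_top (at 0)"

definition has_deriv_minfty :: "(real \<Rightarrow> real) \<Rightarrow> real \<Rightarrow> bool" where
  "has_deriv_minfty f x \<longleftrightarrow> filterlim (\<lambda>h. (f (x + h) - f x) / h) at_bot (at 0)"

definition changes_sign_at :: "(real \<Rightarrow> real) \<Rightarrow> real \<Rightarrow> bool" where
  "changes_sign_at f x \<longleftrightarrow>
     (\<exists>e>0. (\<forall>y\<in>{x-e<..<x}. f y < 0) \<and> (\<forall>y\<in>{x<..<x+e}. f y > 0) \<or>
            (\<forall>y\<in>{x-e<..<x}. f y > 0) \<and> (\<forall>y\<in>{x<..<x+e}. f y < 0))"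

end

theory Submission
  imports Defs
begin

text \<open>
  Put \<open>q = p / m\<close> and \<open>f x = (1 - x cot x) / x\<^sup>2\<close>. Then \<open>g2 p m = 0\<close> means \<open>f p = f q\<close> (with
  \<open>f = \<infinity>\<close> at the multiples of \<open>\<pi>\<close>). Since \<open>f\<close> increases between its poles, \<open>- f = cot \<theta>\<close> for
  an increasing continuous angle \<open>\<theta>\<close>, and the first root is given by \<open>\<theta> q = \<theta> p + \<pi>\<close>. Writing
  \<open>\<sigma> p\<close> for the solution \<open>q\<close> of this equation, \<open>p2\<close> is on \<open>(0, 1)\<close> the inverse function of
  \<open>r p = p / \<sigma> p\<close>. The Riccati equation \<open>x f' = 1 - 3 f + x\<^sup>2 f\<^sup>2\<close> shows that \<open>r' \<ge> 0\<close>, with equality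
  exactly when \<open>f p = 0\<close>, that is \<open>tan p = p\<close>; so \<open>p2\<close> is increasing and continuous, and it is \<open>C\<^sup>1\<close>
  except for infinite derivatives at the ratios of consecutive positive roots of \<open>tan x = x\<close>.
  The bounds come from the sign of \<open>g2\<close> at explicit points, and the case \<open>m > 1\<close> from
  \<open>g2 p m = - m\<^sup>2 * g2 (p / m) (1 / m)\<close>.
\<close>

subsection \<open>The Pruefer angle\<close>

text \<open>In the notation above, f x = \<open>tannum x\<close> / (x^2 sin x). The positive zeros
  of \<open>tannum\<close> are the positive solutions of tan x = x.\<close>

definition tannum :: "real \<Rightarrow> real" where
  "tannum x = sin x - x * cos x"

lemma tannum_has_deriv: "(tannum has_real_derivative x * sin x) (at x)"
  unfolding tannum_def by (rule derivative_eq_intros refl | simp)+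

lemma tannum_pos:
  assumes "0 < x" "x \<le> pi"
  shows "tannum x > 0"
proof -
  have "tannum 0 < tannum x"
  proof (rule DERIV_pos_imp_increasing_open[OF assms(1)])
    fix y assume "0 < y" "y < x"
    then have "y * sin y > 0"
      using assms by (intro mult_pos_pos sin_gt_zero) auto
    then show "\<exists>D. (tannum has_real_derivative D) (at y) \<and> 0 < D"
      using tannum_has_deriv by blast
  next
    show "continuous_on {0..x} tannum"
      unfolding tannum_def by (intro continuous_intros)
  qed
  then show ?thesis by (simp add: tannum_def)
qed

text \<open>On (0, pi) this says f > 1/3, the limit of f at 0; the difference of the two sides has
  derivative y * \<open>tannum y\<close>. It is one half of the bound 5.7 m <
  \<open>p2 m\<close>.\<close>

lemma tannum_bound_sin:
  assumes "0 < x" "x \<le> pi"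
  shows "x\<^sup>2 * sin x < 3 * tannum x"
proof -
  let ?F = "\<lambda>y. 3 * tannum y - y\<^sup>2 * sin y"
  have "?F 0 < ?F x"
  proof (rule DERIV_pos_imp_increasing_open[OF assms(1)])
    fix y assume y: "0 < y" "y < x"
    then have "y * tannum y > 0"
      using assms tannum_pos[of y] by simp
    moreover have "(?F has_real_derivative y * tannum y) (at y)"
      by (rule derivative_eq_intros tannum_has_deriv refl
          | simp add: tannum_def algebra_simps power2_eq_square)+
    ultimately show "\<exists>D. (?F has_real_derivative D) (at y) \<and> 0 < D"
      by blast
  next
    show "continuous_on {0..x} ?F"
      unfolding tannum_def by (intro continuous_intros)
  qed
  then show ?thesis by (simp add: tannum_def)
qed

text \<open>Times x, this is N' D - N D' for N = \<open>tannum\<close> and D = x^2 sin x, so f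
  increases between its poles. Differentiating twice gives 4 sin y * \<open>tannum y\<close>, which
  is positive on (0, pi).\<close>

lemma wronskian_pos:
  fixes x :: real
  assumes "x > 0"
  shows "x\<^sup>2 + x * sin x * cos x - 2 * (sin x)\<^sup>2 > 0"
proof -
  define F where "F y = y\<^sup>2 + y * sin y * cos y - 2 * (sin y)\<^sup>2" for y :: real
  define G where "G y = y + 2 * y * (cos y)\<^sup>2 - 3 * sin y * cos y" for y :: real
  have F': "(F has_real_derivative G y) (at y)" for y
    unfolding F_def G_def
    by (rule derivative_eq_intros refl
        | simp add: algebra_simps power2_eq_square)+
       (use sin_cos_squared_add[of y] in algebra)
  have G': "(G has_real_derivative 4 * sin y * tannum y) (at y)" for y
    unfolding G_def tannum_def
    by (rule derivative_eq_intros refl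
        | simp add: algebra_simps power2_eq_square)+
  have Gpos: "G y > 0" if "y > 0" for y
  proof (cases "y < pi")
    case True
    have "G 0 < G y"
    proof (rule DERIV_pos_imp_increasing_open[OF that])
      fix z assume "0 < z" "z < y"
      then have "4 * sin z * tannum z > 0"
        using True tannum_pos[of z] sin_gt_zero[of z] by simp
      then show "\<exists>D. (G has_real_derivative D) (at z) \<and> 0 < D"
        using G' by blast
    next
      show "continuous_on {0..y} G"
        unfolding G_def by (intro continuous_intros)
    qed
    then show ?thesis by (simp add: G_def)
  next
    case False
    \<comment> \<open>Beyond pi the sign of G' is no longer known, but y itself outweighs 3 sin y
      cos y <= 3/2.\<close>
    then have "y > 3/2"
      using pi_gt3 by linarith
    moreover have "2 * (sin y * cos y) \<le> 1"
      using sin_cos_squared_add[of y] zero_le_power2[of "sin y - cos y"]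
      by (simp add: power2_diff)
    moreover have "y * (cos y)\<^sup>2 \<ge> 0"
      using that by simp
    ultimately show ?thesis
      unfolding G_def by (simp only: mult.assoc)
  qed
  have "F 0 < F x"
  proof (rule DERIV_pos_imp_increasing_open[OF assms])
    show "\<exists>D. (F has_real_derivative D) (at y) \<and> 0 < D" if "0 < y" for y
      using F' Gpos that by blast
  next
    show "continuous_on {0..x} F"
      unfolding F_def by (intro continuous_intros)
  qed
  then show ?thesis by (simp add: F_def)
qed

definition prufer_sq :: "real \<Rightarrow> real" where
  "prufer_sq x = (tannum x)\<^sup>2 + (x\<^sup>2 * sin x)\<^sup>2"

text \<open>The angular speed of the vector with components D = x^2 sin x and N =
  \<open>tannum x\<close>, up to orientation: their Wronskian over the squared length.\<close>

definition prufer_rate :: "real \<Rightarrow> real" where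
  "prufer_rate x = x * (x\<^sup>2 + x * sin x * cos x - 2 * (sin x)\<^sup>2) / prufer_sq x"

lemma prufer_sq_pos:
  assumes "x > 0"
  shows "prufer_sq x > 0"
proof -
  have "tannum x \<noteq> 0 \<or> x\<^sup>2 * sin x \<noteq> 0"
    using assms sin_zero_abs_cos_one[of x] by (auto simp: tannum_def)
  then show ?thesis
    unfolding prufer_sq_def by (metis sum_power2_gt_zero_iff)
qed

lemma prufer_rate_pos: "x > 0 \<Longrightarrow> prufer_rate x > 0"
  unfolding prufer_rate_def using prufer_sq_pos wronskian_pos by simp

lemma isCont_prufer_rate: "x > 0 \<Longrightarrow> isCont prufer_rate x"
  using prufer_sq_pos[of x] unfolding prufer_rate_def prufer_sq_def tannum_def
  by (intro continuous_intros) auto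

text \<open>Integrating the angular speed gives a continuous angle across the poles of f, with no
  branches of arccot to glue. At pi the sine component x^2 sin x vanishes and
  \<open>tannum pi\<close> = pi > 0, so the angle pi is the right normalisation.\<close>

lemma prufer_exists:
  "\<exists>\<theta>. \<theta> pi = pi \<and> (\<forall>x>0. (\<theta> has_real_derivative prufer_rate x) (at x))"
proof -
  obtain F where F: "\<And>x. x > 0 \<Longrightarrow> (F has_real_derivative prufer_rate x) (at x)"
    using einterval_antiderivative[of 0 \<infinity> prufer_rate] isCont_prufer_rate
    by (auto simp: has_real_derivative_iff_has_vector_derivative)
  have "((\<lambda>x. F x - F pi + pi) has_real_derivative prufer_rate x) (at x)" if "x > 0" for x
    by (rule derivative_eq_intros F[OF that] refl | simp)+
  then show ?thesis by (intro exI[of _ "\<lambda>x. F x - F pi + pi"]) auto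
qed

definition prufer :: "real \<Rightarrow> real" where
  "prufer = (SOME \<theta>. \<theta> pi = pi \<and> (\<forall>x>0. (\<theta> has_real_derivative prufer_rate x) (at x)))"

lemma prufer_pi: "prufer pi = pi"
  and prufer_has_deriv: "x > 0 \<Longrightarrow> (prufer has_real_derivative prufer_rate x) (at x)"
  using someI_ex[OF prufer_exists] unfolding prufer_def by auto

lemma isCont_prufer: "x > 0 \<Longrightarrow> isCont prufer x"
  using prufer_has_deriv DERIV_isCont by blast

lemma continuous_on_prufer: "S \<subseteq> {0<..} \<Longrightarrow> continuous_on S prufer"
  by (auto intro!: continuous_at_imp_continuous_on isCont_prufer)

lemma prufer_less:
  assumes "0 < x" "x < y"
  shows "prufer x < prufer y"
proof (rule DERIV_pos_imp_increasing[OF assms(2)])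
  fix z assume "x \<le> z"
  then show "\<exists>D. (prufer has_real_derivative D) (at z) \<and> 0 < D"
    using assms prufer_has_deriv[of z] prufer_rate_pos[of z] by fastforce
qed

lemma prufer_less_iff: "0 < x \<Longrightarrow> 0 < y \<Longrightarrow> prufer x < prufer y \<longleftrightarrow> x < y"
  by (metis prufer_less not_less_iff_gr_or_eq)

lemma prufer_eq_iff: "0 < x \<Longrightarrow> 0 < y \<Longrightarrow> prufer x = prufer y \<longleftrightarrow> x = y"
  by (metis prufer_less less_irrefl linorder_neqE)

text \<open>The unit vector along \<open>(x\<^sup>2 * sin x, - tannum x)\<close> turns with angular speed
  \<open>prufer_rate\<close>, hence it stays at angle \<open>prufer x\<close>.\<close>

lemma prufer_polar:
  assumes "x > 0"
  shows "tannum x = - sqrt (prufer_sq x) * cos (prufer x)"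
    and "x\<^sup>2 * sin x = sqrt (prufer_sq x) * sin (prufer x)"
proof -
  define d where "d y = y\<^sup>2 * sin y / sqrt (prufer_sq y)" for y
  define n where "n y = tannum y / sqrt (prufer_sq y)" for y
  have sq': "(prufer_sq has_real_derivative
      2 * tannum y * (y * sin y) + 2 * (y\<^sup>2 * sin y) * (2 * y * sin y + y\<^sup>2 * cos y)) (at y)" for y
    unfolding prufer_sq_def
    by (rule derivative_eq_intros tannum_has_deriv refl | simp add: algebra_simps)+
  \<comment> \<open>The normalised components satisfy the equations of a rotation with speed
    \<open>prufer_rate\<close>.\<close>
  have dn: "(d has_real_derivative - prufer_rate y * n y) (at y)"
           "(n has_real_derivative prufer_rate y * d y) (at y)" if y: "y > 0" for y
  proof -
    let ?S = "prufer_sq y" and ?N = "tannum y" and ?D = "y\<^sup>2 * sin y"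
    let ?D' = "2 * y * sin y + y\<^sup>2 * cos y"
    let ?X = "?N * (y * sin y) + ?D * ?D'"
    have S: "?S > 0" using prufer_sq_pos y by blast
    then have sS: "sqrt ?S > 0" "sqrt ?S * sqrt ?S = ?S" by auto
    have sqrt': "((\<lambda>y. sqrt (prufer_sq y)) has_real_derivative ?X / sqrt ?S) (at y)"
      using DERIV_real_sqrt_generic[of ?S "inverse (sqrt ?S) / 2"] S
      by (auto intro!: derivative_eq_intros sq' simp: field_simps)
    have W: "y * sin y * ?D - ?N * ?D' = prufer_rate y * ?S"
    proof -
      have "prufer_rate y * ?S = y * (y\<^sup>2 + y * sin y * cos y - 2 * (sin y)\<^sup>2)"
        using S unfolding prufer_rate_def by simp
      then show ?thesis
        using sin_cos_squared_add[of y] unfolding tannum_def by algebra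
    qed
    \<comment> \<open>Here a and b stand for D' and N', and R * S for the Wronskian; both identities
      come from S = N^2 + D^2.\<close>
    have rot: "a * S - D * (N * b + D * a) = - N * (R * S)"
              "b * S - N * (N * b + D * a) = D * (R * S)"
      if "b * D - N * a = R * S" "S = N * N + D * D" for a b D N R S :: real
      using that by algebra+
    have SS: "?S = ?N * ?N + ?D * ?D" by (simp add: prufer_sq_def power2_eq_square)
    have quot: "(a * sqrt ?S - b * (?X / sqrt ?S)) / (sqrt ?S * sqrt ?S) = (a * ?S - b * ?X) / (?S * sqrt ?S)" for a b
    proof -
      have "(a * L - b * (X / L)) / (L * L) = (a * (L * L) - b * X) / ((L * L) * L)"
        if "L \<noteq> 0" for L X :: real
        using that by (simp add: field_simps)
      from this[of "sqrt ?S" ?X] show ?thesis using sS by simp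
    qed
    have D1: "(d has_real_derivative (?D' * sqrt ?S - ?D * (?X / sqrt ?S)) / (sqrt ?S * sqrt ?S)) (at y)"
      unfolding d_def
      by (rule DERIV_divide[OF _ sqrt']) (use sS in \<open>auto intro!: derivative_eq_intros\<close>)
    have "(?D' * sqrt ?S - ?D * (?X / sqrt ?S)) / (sqrt ?S * sqrt ?S)
        = (?D' * ?S - ?D * (?N * (y * sin y) + ?D * ?D')) / (?S * sqrt ?S)"
      by (rule quot)
    also have "?D' * ?S - ?D * (?N * (y * sin y) + ?D * ?D') = - ?N * (prufer_rate y * ?S)"
      by (rule rot(1)[OF W SS])
    also have "- ?N * (prufer_rate y * ?S) / (?S * sqrt ?S) = - prufer_rate y * n y"
      using S sS unfolding n_def by (simp add: field_simps)
    finally show "(d has_real_derivative - prufer_rate y * n y) (at y)" using D1 by simp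
    have N1: "(n has_real_derivative (y * sin y * sqrt ?S - ?N * (?X / sqrt ?S)) / (sqrt ?S * sqrt ?S)) (at y)"
      unfolding n_def
      by (rule DERIV_divide[OF tannum_has_deriv sqrt']) (use sS in auto)
    have "(y * sin y * sqrt ?S - ?N * (?X / sqrt ?S)) / (sqrt ?S * sqrt ?S)
        = (y * sin y * ?S - ?N * (?N * (y * sin y) + ?D * ?D')) / (?S * sqrt ?S)"
      by (rule quot)
    also have "y * sin y * ?S - ?N * (?N * (y * sin y) + ?D * ?D') = ?D * (prufer_rate y * ?S)"
      by (rule rot(2)[OF W SS])
    also have "?D * (prufer_rate y * ?S) / (?S * sqrt ?S) = prufer_rate y * d y"
      using S sS unfolding d_def by (simp add: field_simps)
    finally show "(n has_real_derivative prufer_rate y * d y) (at y)" using N1 by simp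
  qed
  \<comment> \<open>\<open>E1\<close> and \<open>E2\<close> are the components of (d, n) in a frame
    turning with \<open>prufer\<close>. Their derivatives cancel, so they keep the values 0 and -1
    taken at pi.\<close>
  define E1 where "E1 y = d y * cos (prufer y) + n y * sin (prufer y)" for y
  define E2 where "E2 y = n y * cos (prufer y) - d y * sin (prufer y)" for y
  have E: "(E1 has_real_derivative 0) (at y)" "(E2 has_real_derivative 0) (at y)" if "y > 0" for y
    unfolding E1_def E2_def
    by (rule derivative_eq_intros dn[OF that] prufer_has_deriv[OF that] refl
        | simp add: algebra_simps)+
  have const: "f x = f pi" if "\<And>y. y > 0 \<Longrightarrow> (f has_real_derivative 0) (at y)" for f :: "real \<Rightarrow> real"
    by (rule DERIV_zero_connected_constant[of "{0<..}" "{}" f])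
       (use assms that in \<open>auto intro!: continuous_at_imp_continuous_on DERIV_isCont connected_Ioi\<close>)
  have pi: "d pi = 0" "n pi = 1"
    by (auto simp: d_def n_def prufer_sq_def tannum_def)
  have "E1 x = 0" "E2 x = -1"
    using const[of E1] const[of E2] E pi by (auto simp: E1_def E2_def prufer_pi)
  then have e: "d x * cos (prufer x) + n x * sin (prufer x) = 0"
      "n x * cos (prufer x) - d x * sin (prufer x) = -1"
    by (auto simp: E1_def E2_def)
  have "n x = - cos (prufer x)" "d x = sin (prufer x)"
    using e sin_cos_squared_add[of "prufer x"] by algebra+
  then show "tannum x = - sqrt (prufer_sq x) * cos (prufer x)"
      "x\<^sup>2 * sin x = sqrt (prufer_sq x) * sin (prufer x)"
    using prufer_sq_pos[OF assms] unfolding n_def d_def by (simp_all add: field_simps)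
qed

text \<open>This is x f' = 1 - 3 f + x^2 f^2 for f = - cot of the angle, multiplied by the squared
  sine, which removes the poles. Apart from the factor x^2 of the last term, the right side depends
  on the angle modulo pi only.\<close>

lemma prufer_riccati:
  assumes "x > 0"
  shows "x * prufer_rate x =
    (sin (prufer x))\<^sup>2 + 3 * sin (prufer x) * cos (prufer x) + x\<^sup>2 * (cos (prufer x))\<^sup>2"
proof -
  let ?S = "prufer_sq x" and ?s = "sin (prufer x)" and ?c = "cos (prufer x)"
  have S: "?S > 0" "sqrt ?S * sqrt ?S = ?S" using prufer_sq_pos[OF assms] by auto
  have "x * prufer_rate x * ?S = x\<^sup>2 * (x\<^sup>2 * ((sin x)\<^sup>2 + (cos x)\<^sup>2) + x * sin x * cos x - 2 * (sin x)\<^sup>2)"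
    using S unfolding prufer_rate_def by (simp only: sin_cos_squared_add) (simp add: power2_eq_square)
  also have "\<dots> = (x\<^sup>2 * sin x)\<^sup>2 - 3 * tannum x * (x\<^sup>2 * sin x) + x\<^sup>2 * (tannum x)\<^sup>2"
    unfolding tannum_def by algebra
  also have "\<dots> = (?s\<^sup>2 + 3 * ?s * ?c + x\<^sup>2 * ?c\<^sup>2) * (sqrt ?S * sqrt ?S)"
    unfolding prufer_polar[OF assms] by algebra
  finally show ?thesis using S by simp
qed

lemma g2_tannum:
  assumes "m \<noteq> 0"
  shows "g2 p m = tannum p * sin (p / m) - m\<^sup>2 * tannum (p / m) * sin p"
  using assms unfolding g2_def tannum_def by (simp add: field_simps power2_eq_square)

text \<open>The left side is a cross product of the vectors at p and p / m, hence the product of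
  their lengths times the sine of the angle between them. Roots occur where the vectors are
  parallel.\<close>

lemma g2_prufer:
  assumes "p > 0" "m > 0"
  shows "(p / m)\<^sup>2 * g2 p m =
    - (sqrt (prufer_sq p) * sqrt (prufer_sq (p / m))) * sin (prufer (p / m) - prufer p)"
proof -
  define q where "q = p / m"
  have q: "q > 0" "p = m * q" using assms by (auto simp: q_def)
  have "q\<^sup>2 * g2 p m = tannum p * (q\<^sup>2 * sin q) - tannum q * (p\<^sup>2 * sin p)"
    using assms q(2) unfolding g2_tannum[OF less_imp_neq[OF assms(2), symmetric]] q_def[symmetric]
    by (simp add: power2_eq_square algebra_simps)
  also have "\<dots> = - (sqrt (prufer_sq p) * sqrt (prufer_sq q)) * sin (prufer q - prufer p)"
    unfolding prufer_polar[OF assms(1)] prufer_polar[OF q(1)] sin_diff by algebra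
  finally show ?thesis by (simp add: q_def)
qed

section \<open>The angle at the multiples of pi\<close>

lemma sin_prufer_eq_0: "x > 0 \<Longrightarrow> sin (prufer x) = 0 \<longleftrightarrow> sin x = 0"
  using prufer_polar(2)[of x] prufer_sq_pos[of x] by auto

lemma cos_prufer_eq_0: "x > 0 \<Longrightarrow> cos (prufer x) = 0 \<longleftrightarrow> tannum x = 0"
  using prufer_polar(1)[of x] prufer_sq_pos[of x] by auto

lemma prufer_IVT:
  assumes "0 < a" "a \<le> b" "prufer a \<le> y" "y \<le> prufer b"
  obtains x where "a \<le> x" "x \<le> b" "prufer x = y"
proof -
  have "continuous_on {a..b} prufer"
    by (rule continuous_on_prufer) (use assms in auto)
  then show ?thesis
    using IVT'[of prufer a y b] assms that by blast
qed

lemma sin_nonzero_between: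
  assumes "real k * pi < x" "x < real (Suc k) * pi"
  shows "sin x \<noteq> 0"
proof
  assume "sin x = 0"
  then obtain i :: int where i: "x = of_int i * pi"
    by (auto simp: sin_zero_iff_int2)
  have "of_int (int k) < (of_int i :: real)" "of_int i < (of_int (int (Suc k)) :: real)"
    using assms i by (simp_all add: mult_less_cancel_right)
  then have "int k < i" "i < int (Suc k)"
    by (simp_all only: of_int_less_iff)
  then show False by linarith
qed

lemma prufer_pos:
  assumes "x > 0"
  shows "prufer x > 0"
proof (rule ccontr)
  assume "\<not> 0 < prufer x"
  moreover from this have "x < pi"
    using prufer_less_iff[OF assms pi_gt_zero] prufer_pi pi_gt_zero by linarith
  ultimately obtain y where y: "x \<le> y" "y \<le> pi" "prufer y = 0"
    using prufer_IVT[of x pi 0] assms prufer_pi by (metis not_less less_imp_le pi_ge_zero)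
  then have "y \<noteq> pi" using prufer_pi by auto
  then have "sin y > 0" using y assms by (intro sin_gt_zero) auto
  then show False using sin_prufer_eq_0[of y] y assms by auto
qed

text \<open>The sine of the angle vanishes only where sin x does, so the angle meets no multiple of
  pi strictly between two consecutive multiples of pi. The index starts at 1 because the angle is
  controlled on the positive axis only.\<close>

lemma prufer_of_nat_pi: "prufer (real (Suc k) * pi) = real (Suc k) * pi"
proof (induction k)
  case 0
  then show ?case by (simp add: prufer_pi)
next
  case (Suc k)
  let ?a = "real (Suc k) * pi" and ?b = "real (Suc (Suc k)) * pi"
  have pos: "0 < ?a" "?a < ?b" by simp_all
  have "sin ?b = 0" by (rule sin_npi)
  then have "sin (prufer ?b) = 0"
    using sin_prufer_eq_0[of ?b] pos by linarith
  then obtain i :: int where i: "prufer ?b = of_int i * pi"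
    by (auto simp: sin_zero_iff_int2)
  have "?a < prufer ?b"
    using prufer_less[OF pos] Suc by simp
  then have "of_int (int (Suc k)) < (of_int i :: real)"
    unfolding i by (simp add: mult_less_cancel_right)
  then have "int (Suc (Suc k)) \<le> i" by linarith
  then have "real (Suc (Suc k)) \<le> of_int i" by linarith
  \<comment> \<open>The value \<open>?b\<close> is then taken at some y in (\<open>?a\<close>,
    \<open>?b\<close>]. There sin y = 0, which forces y = \<open>?b\<close> and excludes an
    overshoot.\<close>
  then have "?b \<le> prufer ?b"
    unfolding i by (intro mult_right_mono) auto
  then obtain y where y: "?a \<le> y" "y \<le> ?b" "prufer y = ?b"
    using prufer_IVT[of ?a ?b ?b] pos Suc by auto
  have "y \<noteq> ?a" using y(3) Suc pos by auto
  have "sin y = 0"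
    using sin_prufer_eq_0[of y] y pos sin_npi[of "Suc (Suc k)"] by auto
  then have "\<not> (?a < y \<and> y < ?b)"
    using sin_nonzero_between by blast
  then have "y = ?b" using y \<open>y \<noteq> ?a\<close> by linarith
  then show ?case using y by simp
qed

lemma prufer_less_of_nat_pi:
  assumes "x > 0"
  shows "prufer x < real k * pi \<longleftrightarrow> x < real k * pi"
    and "real k * pi < prufer x \<longleftrightarrow> real k * pi < x"
  using assms prufer_pos[OF assms] prufer_of_nat_pi
    prufer_less_iff[of x "real k * pi"] prufer_less_iff[of "real k * pi" x]
  by (cases k; simp)+

text \<open>With k the integer part of x / pi, the angle is at least k pi at x and below (k + 2) pi
  at y. This excludes the second coincidence, an angle difference of 2 pi, as long as p / m <= p +
  pi.\<close>

lemma prufer_add_less_2pi: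
  assumes "0 < x" "0 < y" "y \<le> x + pi"
  shows "prufer y < prufer x + 2 * pi"
proof -
  define k where "k = nat \<lfloor>x / pi\<rfloor>"
  have "real k = of_int \<lfloor>x / pi\<rfloor>" using assms by (simp add: k_def)
  then have "real k \<le> x / pi" "x / pi < real k + 1"
    by linarith+
  then have k: "real k * pi \<le> x" "x < real (Suc k) * pi"
    by (simp_all add: field_simps)
  then have "y < real (k + 2) * pi" using assms by (simp add: algebra_simps)
  then have "prufer y < real (k + 2) * pi"
    using prufer_less_of_nat_pi(1)[OF assms(2), of "k + 2"] by blast
  moreover have "real k * pi \<le> prufer x"
    using prufer_less_of_nat_pi(1)[OF assms(1), of k] k(1) by linarith
  ultimately show ?thesis by (simp add: algebra_simps)
qed

lemma prufer_add_pi_exists: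
  assumes "x > 0"
  shows "\<exists>y>0. prufer y = prufer x + pi"
proof -
  obtain k where k: "prufer x + pi < real k * pi"
    using ex_less_of_nat_mult[of pi "prufer x + pi"] by auto
  moreover have "x < real k * pi"
    using prufer_less_of_nat_pi(1)[OF assms, of k] k pi_gt_zero by linarith
  moreover have "prufer (real k * pi) = real k * pi"
    using prufer_of_nat_pi[of "k - 1"] calculation(2) assms by (cases k) auto
  ultimately obtain y where "x \<le> y" "prufer y = prufer x + pi"
    using prufer_IVT[of x "real k * pi" "prufer x + pi"] assms
    by (metis less_eq_real_def less_add_same_cancel1 pi_gt_zero)
  then show ?thesis using assms by (intro exI[of _ y]) auto
qed

section \<open>The successor map and its ratio\<close>

definition prufer_inv :: "real \<Rightarrow> real" where
  "prufer_inv = inv_into {0<..} prufer"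

definition prufer_succ :: "real \<Rightarrow> real" where
  "prufer_succ x = prufer_inv (prufer x + pi)"

definition succ_ratio :: "real \<Rightarrow> real" where
  "succ_ratio x = x / prufer_succ x"

lemma prufer_inv_prufer: "x > 0 \<Longrightarrow> prufer_inv (prufer x) = x"
  unfolding prufer_inv_def
  by (rule inv_into_f_f) (auto simp: inj_on_def prufer_eq_iff)

lemma prufer_prufer_succ:
  assumes "x > 0"
  shows "prufer_succ x > 0" "prufer (prufer_succ x) = prufer x + pi"
  using prufer_add_pi_exists[OF assms] unfolding prufer_succ_def
  by (metis prufer_inv_prufer)+

lemma prufer_succ_eqI: "0 < y \<Longrightarrow> prufer y = prufer x + pi \<Longrightarrow> prufer_succ x = y"
  unfolding prufer_succ_def by (metis prufer_inv_prufer)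

lemma prufer_succ_greater: "x > 0 \<Longrightarrow> x < prufer_succ x"
  using prufer_prufer_succ[of x] prufer_less_iff[of x "prufer_succ x"] by simp

lemma less_prufer_succ_iff:
  "0 < x \<Longrightarrow> 0 < y \<Longrightarrow> y < prufer_succ x \<longleftrightarrow> prufer y < prufer x + pi"
  using prufer_less_iff[of y "prufer_succ x"] prufer_prufer_succ[of x] by simp

lemma prufer_succ_of_nat_pi:
  "prufer_succ (real (Suc k) * pi) = real (Suc (Suc k)) * pi"
proof (rule prufer_succ_eqI)
  show "0 < real (Suc (Suc k)) * pi" by simp
  show "prufer (real (Suc (Suc k)) * pi) = prufer (real (Suc k) * pi) + pi"
    unfolding prufer_of_nat_pi by (simp add: algebra_simps)
qed

lemma inverse_isCont:
  fixes f g :: "real \<Rightarrow> real"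
  assumes "\<And>y. y > 0 \<Longrightarrow> isCont f y" "\<And>y. y > 0 \<Longrightarrow> g (f y) = y" "x > 0"
  shows "isCont g (f x)"
  by (rule isCont_inverse_function2[of "x / 2" x "2 * x"]) (use assms in auto)

text \<open>Applied to \<open>prufer\<close> with inverse \<open>prufer_inv\<close> and to
  \<open>succ_ratio\<close> with inverse \<open>p2\<close>. The interval from x / 2 to 2 x is a
  neighbourhood of x inside the positive axis.\<close>

lemma inverse_has_deriv:
  fixes f g :: "real \<Rightarrow> real"
  assumes cont: "\<And>y. y > 0 \<Longrightarrow> isCont f y" and inv: "\<And>y. y > 0 \<Longrightarrow> g (f y) = y"
    and mono: "\<And>y z. 0 < y \<Longrightarrow> y < z \<Longrightarrow> f y < f z"
    and x: "x > 0" "(f has_real_derivative d) (at x)" "d \<noteq> 0"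
  shows "(g has_real_derivative inverse d) (at (f x))"
proof (rule DERIV_inverse_function)
  show "isCont g (f x)" by (rule inverse_isCont[OF cont inv x(1)])
  show "(f has_real_derivative d) (at (g (f x)))" using x inv by simp
  show "f (x / 2) < f x" "f x < f (2 * x)" using x by (auto intro: mono)
  fix y assume "f (x / 2) < y" "y < f (2 * x)"
  then obtain z where "x / 2 \<le> z" "f z = y"
    using IVT'[of f "x / 2" y "2 * x"] x cont
    by (force intro: continuous_at_imp_continuous_on)
  then show "f (g y) = y" using inv[of z] x by auto
qed (use x in auto)

lemma prufer_succ_has_deriv:
  assumes "x > 0"
  shows "(prufer_succ has_real_derivative prufer_rate x / prufer_rate (prufer_succ x)) (at x)"
proof -
  let ?s = "prufer_succ x"
  note s = prufer_prufer_succ[OF assms]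
  have "(prufer_inv has_real_derivative inverse (prufer_rate ?s)) (at (prufer ?s))"
    by (rule inverse_has_deriv[of prufer])
       (use s prufer_rate_pos[OF s(1)] in
        \<open>auto intro: isCont_prufer prufer_inv_prufer prufer_less prufer_has_deriv\<close>)
  then have "((\<lambda>x. prufer_inv (prufer x + pi)) has_real_derivative
      inverse (prufer_rate ?s) * (prufer_rate x + 0)) (at x)"
    unfolding s(2)
    by (rule DERIV_chain2) (intro derivative_intros prufer_has_deriv assms)
  then show ?thesis
    unfolding prufer_succ_def[abs_def, symmetric] by (simp add: field_simps)
qed

text \<open>A form of the derivative of \<open>succ_ratio\<close> that shows its sign and its zeros:
  the square of the cosine of the angle, times factors that are positive for x > 0.\<close>

definition succ_ratio_deriv :: "real \<Rightarrow> real" where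
  "succ_ratio_deriv x = ((prufer_succ x)\<^sup>2 - x\<^sup>2) * (cos (prufer x))\<^sup>2 /
     ((prufer_succ x)\<^sup>2 * prufer_rate (prufer_succ x))"

text \<open>By the Riccati equation for \<open>prufer\<close>, the values of \<open>y * prufer_rate y\<close> at \<open>y = x\<close> and at
  \<open>y = prufer_succ x\<close> differ only in the term \<open>y\<^sup>2 * (cos (prufer x))\<^sup>2\<close>.\<close>

lemma succ_ratio_has_deriv:
  assumes "x > 0"
  shows "(succ_ratio has_real_derivative succ_ratio_deriv x) (at x)"
proof -
  let ?s = "prufer_succ x" and ?w = "prufer_rate x" and ?v = "prufer_rate (prufer_succ x)"
  note s = prufer_prufer_succ[OF assms]
  have v: "?v > 0" by (rule prufer_rate_pos[OF s(1)])
  have "?s * ?v - x * ?w = (?s\<^sup>2 - x\<^sup>2) * (cos (prufer x))\<^sup>2"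
    unfolding prufer_riccati[OF s(1)] prufer_riccati[OF assms] s(2)
    by (simp add: algebra_simps)
  then have "(1 * ?s - x * (?w / ?v)) / (?s * ?s) = succ_ratio_deriv x"
    using v s(1) unfolding succ_ratio_deriv_def by (simp add: field_simps power2_eq_square)
  moreover have "(succ_ratio has_real_derivative (1 * ?s - x * (?w / ?v)) / (?s * ?s)) (at x)"
    unfolding succ_ratio_def
    by (rule DERIV_divide[OF DERIV_ident prufer_succ_has_deriv[OF assms]]) (use s in auto)
  ultimately show ?thesis by simp
qed

lemma isCont_succ_ratio: "x > 0 \<Longrightarrow> isCont succ_ratio x"
  using succ_ratio_has_deriv DERIV_isCont by blast

lemma isCont_succ_ratio_deriv:
  assumes "x > 0"
  shows "isCont succ_ratio_deriv x"
proof -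
  note s = prufer_prufer_succ[OF assms]
  have "isCont prufer_succ x"
    using prufer_succ_has_deriv[OF assms] DERIV_isCont by blast
  moreover have "isCont (\<lambda>x. prufer_rate (prufer_succ x)) x"
    by (rule isCont_o2[OF calculation isCont_prufer_rate[OF s(1)]])
  ultimately show ?thesis
    using s prufer_rate_pos[OF s(1)] isCont_prufer[OF assms] unfolding succ_ratio_deriv_def
    by (intro continuous_intros) auto
qed

lemma succ_ratio_deriv_eq_0: "x > 0 \<Longrightarrow> succ_ratio_deriv x = 0 \<longleftrightarrow> tannum x = 0"
  and succ_ratio_deriv_nonneg: "x > 0 \<Longrightarrow> succ_ratio_deriv x \<ge> 0"
proof -
  assume x: "x > 0"
  have "x\<^sup>2 < (prufer_succ x)\<^sup>2"
    using x prufer_succ_greater[OF x] by (intro power_strict_mono) auto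
  then show "succ_ratio_deriv x = 0 \<longleftrightarrow> tannum x = 0" "succ_ratio_deriv x \<ge> 0"
    using prufer_prufer_succ(1)[OF x] prufer_rate_pos[of "prufer_succ x"] cos_prufer_eq_0[OF x]
    unfolding succ_ratio_deriv_def by auto
qed

text \<open>The derivative is nonnegative, so a failure of strictness would make
  \<open>succ_ratio\<close> constant between x and y. Then \<open>tannum\<close> and its derivative
  z sin z would vanish there, but sin z = 0 and \<open>tannum z\<close> = 0 are incompatible for z >
  0.\<close>

lemma succ_ratio_less:
  assumes "0 < x" "x < y"
  shows "succ_ratio x < succ_ratio y"
proof (rule ccontr)
  assume not: "\<not> succ_ratio x < succ_ratio y"
  have mono: "succ_ratio a \<le> succ_ratio b" if "x \<le> a" "a \<le> b" for a b
  proof (rule DERIV_nonneg_imp_nondecreasing[OF that(2)])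
    fix c assume "a \<le> c"
    then have "c > 0" using that assms by auto
    then show "\<exists>D. (succ_ratio has_real_derivative D) (at c) \<and> 0 \<le> D"
      using succ_ratio_has_deriv succ_ratio_deriv_nonneg by blast
  qed
  have const: "succ_ratio z = succ_ratio x" if "z \<in> {x<..<y}" for z
    using mono[of x z] mono[of z y] that not by auto
  have N0: "tannum z = 0" if z: "z \<in> {x<..<y}" for z
  proof -
    have "(succ_ratio has_real_derivative 0) (at z)"
      by (rule has_field_derivative_transform_within_open[of "\<lambda>_. succ_ratio x" 0 z "{x<..<y}"])
         (use z const in auto)
    then have "succ_ratio_deriv z = 0"
      using DERIV_unique succ_ratio_has_deriv[of z] z assms by auto
    then show ?thesis using succ_ratio_deriv_eq_0[of z] z assms by auto
  qed
  obtain z where z: "z \<in> {x<..<y}" using dense[OF assms(2)] by auto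
  have "(tannum has_real_derivative 0) (at z)"
    by (rule has_field_derivative_transform_within_open[of "\<lambda>_. 0" 0 z "{x<..<y}"])
       (use z N0 in auto)
  then have "sin z = 0"
    using DERIV_unique[OF tannum_has_deriv] z assms by fastforce
  then show False
    using N0[OF z] z assms sin_zero_abs_cos_one[of z] by (auto simp: tannum_def)
qed

lemma succ_ratio_less_iff: "0 < x \<Longrightarrow> 0 < y \<Longrightarrow> succ_ratio x < succ_ratio y \<longleftrightarrow> x < y"
  by (metis succ_ratio_less not_less_iff_gr_or_eq)

lemma succ_ratio_bounds:
  assumes "x > 0"
  shows "0 < succ_ratio x" "succ_ratio x < 1"
  using assms prufer_succ_greater[OF assms] unfolding succ_ratio_def by auto

lemma succ_ratio_of_nat_pi: "succ_ratio (real (Suc k) * pi) = real (Suc k) / real (Suc (Suc k))"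
  unfolding succ_ratio_def prufer_succ_of_nat_pi by simp

lemma succ_ratio_surj:
  assumes "0 < m" "m < 1"
  obtains x where "x > 0" "succ_ratio x = m"
proof -
  \<comment> \<open>As \<open>prufer_succ\<close> exceeds pi, the ratio at m pi / 2 is at most m /
    2.\<close>
  let ?a = "m * pi / 2"
  have a: "?a > 0" using assms by simp
  have "prufer_succ ?a > pi"
    using less_prufer_succ_iff[OF a pi_gt_zero] prufer_pi prufer_pos[OF a] by simp
  then have "succ_ratio ?a \<le> ?a / pi"
    unfolding succ_ratio_def using a prufer_prufer_succ(1)[OF a]
    by (intro divide_left_mono mult_pos_pos) auto
  also have "\<dots> \<le> m" using assms by simp
  finally have lo: "succ_ratio ?a \<le> m" .
  \<comment> \<open>The ratios at multiples of pi are (k + 1) / (k + 2) and tend to 1; this k makes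
    such a ratio at least m.\<close>
  obtain k :: nat where k: "real k > 1 / (1 - m)" using reals_Archimedean2 by blast
  let ?b = "real (Suc k) * pi"
  have "m \<le> real (Suc k) / real (Suc (Suc k))"
    using k assms by (simp add: field_simps)
  then have hi: "m \<le> succ_ratio ?b" unfolding succ_ratio_of_nat_pi .
  have "m * pi \<le> 1 * pi" using assms by (intro mult_right_mono) auto
  then have "?a \<le> ?b" using pi_gt_zero by (simp add: algebra_simps add_increasing2)
  then obtain x where "?a \<le> x" "succ_ratio x = m"
    using IVT'[of succ_ratio ?a m ?b] lo hi a isCont_succ_ratio
    by (force intro: continuous_at_imp_continuous_on)
  moreover from this have "x > 0" using a by linarith
  ultimately show ?thesis using that by blast
qed

subsection \<open>The first root for \<open>m < 1\<close>\<close>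

lemma g2_sign:
  assumes "p > 0" "m > 0"
  shows "g2 p m < 0 \<longleftrightarrow> sin (prufer (p / m) - prufer p) > 0"
    and "g2 p m = 0 \<longleftrightarrow> sin (prufer (p / m) - prufer p) = 0"
    and "g2 p m > 0 \<longleftrightarrow> sin (prufer (p / m) - prufer p) < 0"
proof -
  define c s where "c = sqrt (prufer_sq p) * sqrt (prufer_sq (p / m)) / (p / m)\<^sup>2"
    and "s = sin (prufer (p / m) - prufer p)"
  have c: "c > 0" unfolding c_def using prufer_sq_pos assms by simp
  have "g2 p m = - c * s"
    using g2_prufer[OF assms] assms unfolding c_def s_def by (simp add: field_simps)
  then show "g2 p m < 0 \<longleftrightarrow> s > 0" "g2 p m = 0 \<longleftrightarrow> s = 0" "g2 p m > 0 \<longleftrightarrow> s < 0"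
    using c by (auto simp: zero_less_mult_iff mult_less_0_iff)
qed

text \<open>Both comparisons decide on which side of \<open>prufer_succ p\<close> the point p / m
  lies.\<close>

lemma prufer_add_pi_compare:
  assumes "p > 0" "m > 0"
  shows "prufer (p / m) < prufer p + pi \<longleftrightarrow> succ_ratio p < m"
    and "prufer p + pi < prufer (p / m) \<longleftrightarrow> m < succ_ratio p"
proof -
  note s = prufer_prufer_succ[OF assms(1)]
  have "p / m < prufer_succ p \<longleftrightarrow> succ_ratio p < m" "prufer_succ p < p / m \<longleftrightarrow> m < succ_ratio p"
    using s(1) assms unfolding succ_ratio_def by (auto simp: field_simps)
  then show "prufer (p / m) < prufer p + pi \<longleftrightarrow> succ_ratio p < m"
    "prufer p + pi < prufer (p / m) \<longleftrightarrow> m < succ_ratio p"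
    using prufer_less_iff[of "p / m" "prufer_succ p"] prufer_less_iff[of "prufer_succ p" "p / m"]
      assms s by auto
qed

lemma g2_neg_below:
  assumes m: "0 < m" "m < 1" and p: "0 < p" "succ_ratio p < m"
  shows "g2 p m < 0"
proof -
  have "prufer p < prufer (p / m)"
    using m p by (intro prufer_less) (auto simp: field_simps)
  then show ?thesis
    using prufer_add_pi_compare(1)[OF p(1) m(1)] p unfolding g2_sign(1)[OF p(1) m(1)]
    by (intro sin_gt_zero) auto
qed

lemma g2_eq_0_at_ratio:
  assumes "x > 0"
  shows "g2 x (succ_ratio x) = 0"
proof -
  have "x / succ_ratio x = prufer_succ x"
    using assms prufer_prufer_succ(1)[OF assms] unfolding succ_ratio_def by simp
  then show ?thesis
    using g2_sign(2)[OF assms succ_ratio_bounds(1)[OF assms]] prufer_prufer_succ(2)[OF assms] by simp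
qed

text \<open>The angle difference lies strictly between pi and 2 pi. The last hypothesis gives the
  upper end, past which the sine becomes positive again.\<close>

lemma g2_pos_above:
  assumes m: "0 < m" "m < 1" and p: "0 < p" "m < succ_ratio p" "prufer (p / m) < prufer p + 2 * pi"
  shows "g2 p m > 0"
proof -
  have "prufer p + pi < prufer (p / m)"
    using prufer_add_pi_compare(2)[OF p(1) m(1)] p by blast
  then have "sin (prufer (p / m) - prufer p - pi) > 0"
    using p by (intro sin_gt_zero) auto
  then show ?thesis
    unfolding g2_sign(3)[OF p(1) m(1)] by (simp add: sin_diff)
qed

text \<open>To the left of x the ratio is smaller, so \<open>g2\<close> is negative there and x is
  the first root. Hence \<open>p2\<close> inverts \<open>succ_ratio\<close>.\<close>

lemma p2_succ_ratio:
  assumes "x > 0"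
  shows "p2 (succ_ratio x) = x"
  unfolding p2_def
proof (rule Least_equality)
  show "0 < x \<and> g2 x (succ_ratio x) = 0"
    using assms g2_eq_0_at_ratio by blast
next
  fix p assume "0 < p \<and> g2 p (succ_ratio x) = 0"
  then show "x \<le> p"
    using g2_neg_below[of "succ_ratio x" p] succ_ratio_bounds[OF assms] assms
      succ_ratio_less_iff[of p x] by fastforce
qed

lemma p2_pos: "0 < m \<Longrightarrow> m < 1 \<Longrightarrow> p2 m > 0"
  and succ_ratio_p2: "0 < m \<Longrightarrow> m < 1 \<Longrightarrow> succ_ratio (p2 m) = m"
  by (metis succ_ratio_surj p2_succ_ratio)+

lemma p2_less_iff: "0 < p \<Longrightarrow> 0 < m \<Longrightarrow> m < 1 \<Longrightarrow> p2 m < p \<longleftrightarrow> m < succ_ratio p"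
  and less_p2_iff: "0 < p \<Longrightarrow> 0 < m \<Longrightarrow> m < 1 \<Longrightarrow> p < p2 m \<longleftrightarrow> succ_ratio p < m"
  by (metis p2_pos succ_ratio_p2 succ_ratio_less_iff)+

lemma p2_mono: "0 < m \<Longrightarrow> m < n \<Longrightarrow> n < 1 \<Longrightarrow> p2 m < p2 n"
  using p2_less_iff[of "p2 n" m] p2_pos[of n] succ_ratio_p2[of n] by simp

lemma g2_p2: "0 < m \<Longrightarrow> m < 1 \<Longrightarrow> g2 (p2 m) m = 0"
  using g2_eq_0_at_ratio[of "p2 m"] p2_pos succ_ratio_p2 by simp

lemma g2_neg_below_p2: "0 < m \<Longrightarrow> m < 1 \<Longrightarrow> 0 < p \<Longrightarrow> p < p2 m \<Longrightarrow> g2 p m < 0"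
  using g2_neg_below less_p2_iff by blast

lemma p2_lessI:
  assumes "0 < m" "m < 1" "0 < p" "g2 p m > 0"
  shows "p2 m < p"
  using assms g2_neg_below_p2[of m p] g2_p2[of m] by (metis less_asym less_irrefl not_less_iff_gr_or_eq)

text \<open>Unlike a positive value in \<open>p2_lessI\<close>, a negative value could also occur
  past a later root; the bound by 2 pi rules this out.\<close>

lemma less_p2I:
  assumes "0 < m" "m < 1" "0 < p" "g2 p m < 0" "prufer (p / m) < prufer p + 2 * pi"
  shows "p < p2 m"
  using assms g2_pos_above[of m p] g2_p2[of m] p2_less_iff[of p m]
  by (metis less_asym less_irrefl not_less_iff_gr_or_eq)

text \<open>At \<open>p2 m\<close> the angle difference is exactly pi, so by continuity it stays
  below 2 pi nearby.\<close>

lemma g2_pos_above_p2: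
  assumes "0 < m" "m < 1"
  shows "\<exists>e>0. \<forall>p\<in>{p2 m<..<p2 m + e}. g2 p m > 0"
proof -
  let ?F = "\<lambda>p. prufer p + 2 * pi - prufer (p / m)"
  have pos: "p2 m > 0" by (rule p2_pos[OF assms])
  have "p2 m / m = prufer_succ (p2 m)"
    using succ_ratio_p2[OF assms] pos assms prufer_prufer_succ(1)[OF pos]
    unfolding succ_ratio_def by (simp add: field_simps)
  then have "?F (p2 m) > 0"
    using prufer_prufer_succ(2)[OF pos] by simp
  moreover have "isCont ?F (p2 m)"
    using isCont_prufer[OF pos] isCont_prufer[of "p2 m / m"] pos assms
    by (intro continuous_intros isCont_o2[of _ "\<lambda>p. p / m" prufer]) auto
  ultimately have "eventually (\<lambda>p. ?F p > 0) (at (p2 m))"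
    unfolding isCont_def by (rule order_tendstoD(1)[rotated])
  then obtain e where e: "e > 0" "\<And>p. p \<noteq> p2 m \<Longrightarrow> dist p (p2 m) < e \<Longrightarrow> ?F p > 0"
    unfolding eventually_at by blast
  have "g2 p m > 0" if "p \<in> {p2 m<..<p2 m + e}" for p
    using g2_pos_above[OF assms, of p] e(2)[of p] p2_less_iff[of p m] that assms pos
    by (auto simp: dist_real_def)
  with e(1) show ?thesis by blast
qed

section \<open>Regularity of \<open>p2\<close> on (0, 1)\<close>

lemma isCont_p2: "0 < m \<Longrightarrow> m < 1 \<Longrightarrow> isCont p2 m"
  using inverse_isCont[of succ_ratio p2 "p2 m"] isCont_succ_ratio p2_succ_ratio succ_ratio_p2 p2_pos
  by simp

lemma p2_has_deriv:
  assumes "0 < m" "m < 1" "tannum (p2 m) \<noteq> 0"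
  shows "(p2 has_real_derivative inverse (succ_ratio_deriv (p2 m))) (at m)"
proof -
  have pos: "p2 m > 0" by (rule p2_pos[OF assms(1,2)])
  have "(p2 has_real_derivative inverse (succ_ratio_deriv (p2 m))) (at (succ_ratio (p2 m)))"
    by (rule inverse_has_deriv[of succ_ratio])
       (use pos assms succ_ratio_deriv_eq_0[OF pos] in
        \<open>auto intro: isCont_succ_ratio p2_succ_ratio succ_ratio_less succ_ratio_has_deriv\<close>)
  then show ?thesis using succ_ratio_p2[OF assms(1,2)] by simp
qed

lemma C1_at_p2:
  assumes "0 < m" "m < 1" "tannum (p2 m) \<noteq> 0"
  shows "C1_at p2 m"
proof -
  \<comment> \<open>On this open set the formula of \<open>p2_has_deriv\<close> holds at every point
    and is continuous.\<close>
  define U where "U = {m \<in> {0<..<1}. tannum (p2 m) \<noteq> 0}"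
  have U_eq: "U = {0<..<1} \<inter> (\<lambda>m. tannum (p2 m)) -` (- {0})"
    unfolding U_def by auto
  have "continuous_on {0<..<1} p2"
    by (auto intro!: continuous_at_imp_continuous_on isCont_p2)
  then have "continuous_on {0<..<1} (\<lambda>m. tannum (p2 m))"
    unfolding tannum_def by (intro continuous_intros)
  then have "open U"
    unfolding U_eq by (intro continuous_open_preimage) auto
  moreover have "m \<in> U" using assms by (auto simp: U_def)
  moreover have "p2 C1_differentiable_on U"
    unfolding C1_differentiable_on_def
  proof (intro exI conjI ballI)
    fix x assume x: "x \<in> U"
    then show "(p2 has_vector_derivative inverse (succ_ratio_deriv (p2 x))) (at x)"
      using p2_has_deriv[of x] by (auto simp: U_def has_real_derivative_iff_has_vector_derivative)
  next
    show "continuous_on U (\<lambda>x. inverse (succ_ratio_deriv (p2 x)))"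
    proof (intro continuous_at_imp_continuous_on ballI)
      fix x assume x: "x \<in> U"
      then have pos: "p2 x > 0" by (auto simp: U_def intro: p2_pos)
      have "isCont (\<lambda>x. succ_ratio_deriv (p2 x)) x"
        by (rule isCont_o2[OF isCont_p2 isCont_succ_ratio_deriv[OF pos]]) (use x in \<open>auto simp: U_def\<close>)
      then show "isCont (\<lambda>x. inverse (succ_ratio_deriv (p2 x))) x"
        using x pos succ_ratio_deriv_eq_0[OF pos] by (intro continuous_intros) (auto simp: U_def)
    qed
  qed
  ultimately show ?thesis unfolding C1_at_def by blast
qed

text \<open>Difference quotients of \<open>p2\<close> are reciprocals of those of
  \<open>succ_ratio\<close>. The latter tend to 0 where \<open>tannum\<close> vanishes, and they are
  positive by monotonicity.\<close>

lemma p2_deriv_pinfty: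
  assumes m: "0 < m" "m < 1" and N0: "tannum (p2 m) = 0"
  shows "has_deriv_pinfty p2 m"
proof -
  let ?x = "p2 m"
  have pos: "?x > 0" by (rule p2_pos[OF m])
  let ?Q = "\<lambda>y. (succ_ratio y - m) / (y - ?x)"
  have "(succ_ratio has_real_derivative 0) (at ?x)"
    using succ_ratio_has_deriv[OF pos] succ_ratio_deriv_eq_0[OF pos] N0 by simp
  then have Q0: "(?Q \<longlongrightarrow> 0) (at ?x)"
    unfolding has_field_derivative_iff succ_ratio_p2[OF m] .
  have ev: "eventually (\<lambda>h. m + h \<in> {0<..<1}) (at 0)"
  proof -
    have "((\<lambda>h. m + h) \<longlongrightarrow> m + 0) (at 0)" by (intro tendsto_intros)
    then show ?thesis using m by (intro topological_tendstoD) auto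
  qed
  have lim: "filterlim (\<lambda>h. p2 (m + h)) (at ?x) (at 0)"
  proof (rule filterlim_atI)
    show "((\<lambda>h. p2 (m + h)) \<longlongrightarrow> ?x) (at 0)"
      using isCont_p2[OF m] by (simp add: isCont_iff)
    have "eventually (\<lambda>h::real. h \<noteq> 0) (at 0)" by (simp add: eventually_at_filter)
    with ev show "eventually (\<lambda>h. p2 (m + h) \<noteq> ?x) (at 0)"
      by eventually_elim (metis greaterThanLessThan_iff succ_ratio_p2 m add_cancel_right_right)
  qed
  have Q: "((\<lambda>h. ?Q (p2 (m + h))) \<longlongrightarrow> 0) (at 0)"
    by (rule filterlim_compose[OF Q0 lim])
  have "eventually (\<lambda>h::real. h \<noteq> 0) (at 0)" by (simp add: eventually_at_filter)
  with ev have "eventually (\<lambda>h. ?Q (p2 (m + h)) > 0) (at 0)"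
  proof eventually_elim
    case (elim h)
    then have "succ_ratio (p2 (m + h)) = m + h" by (intro succ_ratio_p2) auto
    then show ?case
      using elim p2_mono[of m "m + h"] p2_mono[of "m + h" m] m
      by (cases "h > 0") (auto simp: divide_neg_neg)
  qed
  from filterlim_inverse_at_top[OF Q this]
  have top: "filterlim (\<lambda>h. inverse (?Q (p2 (m + h)))) at_top (at 0)" .
  show ?thesis
    unfolding has_deriv_pinfty_def
  proof (rule filterlim_mono_eventually[OF top order_refl order_refl])
    from ev show "eventually (\<lambda>h. inverse (?Q (p2 (m + h))) = (p2 (m + h) - p2 m) / h) (at 0)"
      by eventually_elim (simp add: succ_ratio_p2)
  qed
qed

subsection \<open>Comparison with \<open>\<pi> m / (1 - m)\<close>\<close>

lemma arctan_lower:
  fixes x :: real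
  assumes "0 \<le> x"
  shows "x - x ^ 3 / 3 \<le> arctan x"
proof -
  let ?F = "\<lambda>x::real. arctan x - (x - x ^ 3 / 3)"
  have "?F 0 \<le> ?F x"
  proof (rule DERIV_nonneg_imp_nondecreasing[OF assms])
    fix y :: real
    have "(1 - y\<^sup>2) * (1 + y\<^sup>2) \<le> 1" by (simp add: algebra_simps)
    then have "1 - y\<^sup>2 \<le> inverse (1 + y\<^sup>2)"
      by (simp add: divide_simps add_pos_nonneg)
    then show "\<exists>D. (?F has_real_derivative D) (at y) \<and> 0 \<le> D"
      by (intro exI[of _ "inverse (1 + y\<^sup>2) - (1 - y\<^sup>2)"] conjI)
         (auto intro!: derivative_eq_intros)
  qed
  then show ?thesis by simp
qed

text \<open>Machin's formula, with arctan (1/5) bounded below by its cubic Taylor polynomial and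
  arctan (1/239) bounded above by its argument.\<close>

lemma pi_lower: "3.14 \<le> pi"
proof -
  have "arctan (1 / 239) \<le> 1 / 239" by (rule arctan_le_self) simp
  moreover have "1 / 5 - (1 / 5) ^ 3 / 3 \<le> arctan (1 / 5)" by (rule arctan_lower) simp
  ultimately show ?thesis using machin by (simp add: power3_eq_cube)
qed

lemma line_div:
  fixes m :: real
  assumes "0 < m" "m < 1"
  shows "pi * m / (1 - m) / m = pi * m / (1 - m) + pi"
  using assms by (simp add: field_simps)

text \<open>On the curve p = pi m / (1 - m) one has p / m = p + pi, so sin p factors out of
  \<open>g2\<close>. The sign (-1)^k from the shift by k pi occurs twice and cancels.\<close>

lemma g2_on_line:
  assumes m: "0 < m" "m < 1" and P: "pi * m / (1 - m) = real k * pi + z"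
  shows "g2 (pi * m / (1 - m)) m =
    (1 - m) * sin z * ((real k * pi + z) * cos z - (1 + m) * sin z)"
proof -
  define P where "P = real k * pi + z"
  have mP: "m * (P + pi) = P"
    using line_div[OF m] m assms(3) unfolding P_def by (simp add: field_simps)
  have sc: "sin P = (-1) ^ k * sin z" "cos P = (-1) ^ k * cos z"
    unfolding P_def by (simp_all add: sin_add cos_add)
  have e: "((-1) ^ k :: real) * (-1) ^ k = 1"
    by (simp flip: power_add)
  have "g2 P m = m * P * cos (P + pi) * sin P - (P * cos P + (m\<^sup>2 - 1) * sin P) * sin (P + pi)"
    unfolding g2_def using line_div[OF m] assms(3) by (simp add: P_def)
  also have "\<dots> = sin P * ((1 - m) * P * cos P - (1 - m\<^sup>2) * sin P)"
    by (simp add: algebra_simps)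
  also have "\<dots> = ((-1) ^ k * (-1) ^ k) * ((1 - m) * sin z * (P * cos z - (1 + m) * sin z))"
    unfolding sc by algebra
  finally show ?thesis unfolding e assms(3) P_def by simp
qed

lemma p2_below_line:
  assumes m: "0 < m" "m < 1" and P: "pi * m / (1 - m) = real k * pi + z"
    and z: "0 < z" "z < pi" "(1 + m) * sin z < (real k * pi + z) * cos z"
  shows "p2 m < pi * m / (1 - m)"
proof (rule p2_lessI[OF m])
  show "g2 (pi * m / (1 - m)) m > 0"
    unfolding g2_on_line[OF m P] using m z sin_gt_zero[of z] by simp
qed (use m in simp)

lemma p2_above_line:
  assumes m: "0 < m" "m < 1" and P: "pi * m / (1 - m) = real k * pi + z"
    and z: "0 < z" "z < pi" "(real k * pi + z) * cos z < (1 + m) * sin z"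
  shows "p2 m > pi * m / (1 - m)"
proof (rule less_p2I[OF m])
  show "g2 (pi * m / (1 - m)) m < 0"
    unfolding g2_on_line[OF m P] using m z sin_gt_zero[of z] by (simp add: mult_less_0_iff)
  show "prufer (pi * m / (1 - m) / m) < prufer (pi * m / (1 - m)) + 2 * pi"
    unfolding line_div[OF m] by (rule prufer_add_less_2pi) (use m in \<open>auto intro: add_pos_pos\<close>)
qed (use m in simp)

lemma line_mono:
  fixes m n :: real
  assumes "m < n" "n < 1"
  shows "pi * m / (1 - m) < pi * n / (1 - n)"
  using assms by (simp add: divide_simps algebra_simps)

lemma line_at_ratio: "c > 0 \<Longrightarrow> pi * (a / c) / (1 - a / c) = pi * a / (c - a)" for a c :: real
  by (simp add: field_simps)

text \<open>The cubic denominator factors as (3 + 2 k) (4 k^2 + 10 k + 5), and the first factor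
  cancels.\<close>

lemma lo1_eq: "lo1 k = (4 * real k ^ 2 + 6 * real k + 1) / (4 * real k ^ 2 + 10 * real k + 5)"
proof -
  let ?k = "real k"
  have "15 + 40 * ?k + 32 * ?k ^ 2 + 8 * ?k ^ 3 = (3 + 2 * ?k) * (4 * ?k ^ 2 + 10 * ?k + 5)"
    by algebra
  moreover have "(1 + 2 * ?k) * (4 * ?k ^ 2 + 10 * ?k + 5) - 2 = (3 + 2 * ?k) * (4 * ?k ^ 2 + 6 * ?k + 1)"
    by algebra
  moreover have "x / a - 2 / (a * b) = e / b" if "a > 0" "b > 0" "x * b - 2 = a * e" for x a b e :: real
  proof -
    have "x / a - 2 / (a * b) = (x * b - 2) / (a * b)" using that by (simp add: field_simps)
    then show ?thesis using that by simp
  qed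
  moreover have "3 + 2 * ?k > 0" "4 * ?k ^ 2 + 10 * ?k + 5 > 0" by (auto simp: add_nonneg_pos)
  ultimately show ?thesis
    unfolding lo1_def by metis
qed

text \<open>This explains the constants: on the curve, \<open>lo1 k\<close> corresponds to a point
  pi / (4 (k + 1)) short of k pi + pi / 2, and \<open>hi1 k\<close> to k pi + pi / 2 itself.\<close>

lemma line_lo1: "pi * lo1 k / (1 - lo1 k) = real k * pi + (pi / 2 - pi / (4 * (real k + 1)))"
proof -
  let ?k = "real k"
  have "4 * ?k ^ 2 + 10 * ?k + 5 > 0" by (auto simp: add_nonneg_pos)
  then have "pi * lo1 k / (1 - lo1 k) = pi * (4 * ?k ^ 2 + 6 * ?k + 1) / (4 * (?k + 1))"
    unfolding lo1_eq by (subst line_at_ratio) simp_all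
  also have "\<dots> = ?k * pi + (pi / 2 - pi / (4 * (?k + 1)))"
    by (simp add: field_simps power2_eq_square)
  finally show ?thesis .
qed

lemma line_hi1: "pi * hi1 k / (1 - hi1 k) = real k * pi + pi / 2"
  unfolding hi1_def by (simp add: line_at_ratio field_simps)

lemma ratio_lo1_hi1:
  shows "real k / (1 + real k) < lo1 k" "lo1 k < hi1 k"
    "hi1 k < (1 + real k) / (2 + real k)"
proof -
  let ?k = "real k"
  have pos: "4 * ?k ^ 2 + 10 * ?k + 5 > 0" by (auto simp: add_nonneg_pos)
  moreover have "?k * (4 * ?k ^ 2 + 10 * ?k + 5) < (4 * ?k ^ 2 + 6 * ?k + 1) * (1 + ?k)"
    by (simp add: algebra_simps power2_eq_square)
  ultimately show "?k / (1 + ?k) < lo1 k"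
    unfolding lo1_eq by (simp add: frac_less_eq divide_less_eq less_divide_eq)
  have "15 + 40 * ?k + 32 * ?k ^ 2 + 8 * ?k ^ 3 > 0" by (simp add: add_pos_nonneg)
  then show "lo1 k < hi1 k" unfolding lo1_def hi1_def by simp
  show "hi1 k < (1 + ?k) / (2 + ?k)"
    unfolding hi1_def by (simp add: divide_less_eq less_divide_eq algebra_simps)
qed

lemma lo1_hi1_less_1: "lo1 k < 1" "hi1 k < 1"
proof -
  have "(1 + real k) / (2 + real k) < 1" by simp
  then show "lo1 k < 1" "hi1 k < 1" using ratio_lo1_hi1[of k] by linarith+
qed

lemma p2_at_ratio:
  assumes "k \<ge> 1"
  shows "p2 (real k / (1 + real k)) = real k * pi"
proof -
  obtain j where "k = Suc j" using assms by (cases k) auto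
  then show ?thesis
    using p2_succ_ratio[of "real k * pi"] succ_ratio_of_nat_pi[of j] by (simp add: add_ac)
qed

text \<open>With y = pi / 2 - z the condition reads (1 + m) cos y < P sin y, where P is the point on
  the curve. Since tan y >= y, it suffices that P y > 1 + m, and the worst case is the value y0 of y
  at \<open>lo1 k\<close>.\<close>

lemma cosine_condition_below_lo1:
  assumes k: "k \<ge> 1" and m: "real k / (1 + real k) < m" "m \<le> lo1 k"
  defines "z \<equiv> pi * m / (1 - m) - real k * pi"
  shows "0 < z" "z < pi / 2" "(1 + m) * sin z < (real k * pi + z) * cos z"
proof -
  define K where "K = real k + 1"
  have K: "K \<ge> 2" using k by (simp add: K_def)
  have lo: "lo1 k < 1" using lo1_hi1_less_1[of k] by simp
  then have m1: "m < 1" using m by simp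
  have "pi * (real k / (1 + real k)) / (1 - real k / (1 + real k)) = real k * pi"
    by (subst line_at_ratio) auto
  then show z0: "0 < z" using line_mono[OF m(1) m1] by (simp add: z_def)
  define y where "y = pi / 2 - z"
  define y0 where "y0 = pi / (4 * K)"
  have "pi * m / (1 - m) \<le> pi * lo1 k / (1 - lo1 k)"
    using line_mono[of m "lo1 k"] m lo by (cases "m = lo1 k") auto
  then have "y0 \<le> y"
    unfolding line_lo1 by (simp add: y_def y0_def z_def K_def)
  moreover have "y < pi / 2" using z0 by (simp add: y_def)
  ultimately have y: "y0 \<le> y" "y < pi / 2" .
  have y0: "0 < y0" using K by (simp add: y0_def)
  then show "z < pi / 2" using y by (simp add: y_def)
  define P where "P = real k * pi + z"
  have P: "P = pi * (K - 1/2) - y" by (simp add: P_def y_def K_def algebra_simps)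
  have "pi * (3 / 2) \<le> pi * (K - 1/2)"
    using K by (intro mult_left_mono) auto
  then have "y + y0 \<le> pi * (K - 1/2)"
    using y y0 pi_gt_zero by linarith
  \<comment> \<open>P y is a concave quadratic in y; this sign shows that it is at least its value
    at y0.\<close>
  then have "0 \<le> (y - y0) * (pi * (K - 1/2) - y - y0)"
    using y y0 by (intro mult_nonneg_nonneg) auto
  moreover have gap: "(y - y0) * (C - y - y0) = (C - y) * y - (C - y0) * y0" for C
    by algebra
  ultimately have "(pi * (K - 1/2) - y0) * y0 \<le> P * y"
    unfolding P by (simp add: gap)
  moreover have "(pi * (K - 1/2) - y0) * y0 = pi\<^sup>2 / 4 * ((4 * K\<^sup>2 - 2 * K - 1) / (4 * K\<^sup>2))"
    using K unfolding y0_def by (simp add: field_simps power2_eq_square)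
  \<comment> \<open>The constant 12/5 is a rational lower bound for pi^2 / 4, since 3.1^2 / 4 >
    2.4.\<close>
  moreover have "12 / 5 * ((4 * K\<^sup>2 - 2 * K - 1) / (4 * K\<^sup>2)) \<le> pi\<^sup>2 / 4 * ((4 * K\<^sup>2 - 2 * K - 1) / (4 * K\<^sup>2))"
  proof (rule mult_right_mono)
    have "3.1 \<le> pi" using pi_lower by simp
    then have "3.1\<^sup>2 \<le> pi\<^sup>2" by (intro power_mono) auto
    then show "12 / 5 \<le> pi\<^sup>2 / 4" by (simp add: power2_eq_square)
    have "2 * K \<le> K * K" using K by (intro mult_right_mono) auto
    then have "0 \<le> 4 * K\<^sup>2 - 2 * K - 1" using K unfolding power2_eq_square by linarith
    then show "0 \<le> (4 * K\<^sup>2 - 2 * K - 1) / (4 * K\<^sup>2)" by simp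
  qed
  moreover have "1 + m < 12 / 5 * ((4 * K\<^sup>2 - 2 * K - 1) / (4 * K\<^sup>2))"
  proof -
    \<comment> \<open>Clearing denominators leaves 32 L^2 - 104 L + 12 > 0, which holds because K >=
      2 gives L >= 4.\<close>
    define L where "L = K\<^sup>2"
    have L: "L \<ge> 4" using power_mono[OF K, of 2] by (simp add: L_def)
    have dpos: "4 * L + 2 * K - 1 > 0" using L K by simp
    have "1 + m \<le> 1 + lo1 k" using m by simp
    also have "1 + lo1 k = (8 * L - 2) / (4 * L + 2 * K - 1)"
    proof -
      have "4 * real k ^ 2 + 10 * real k + 5 = 4 * L + 2 * K - 1"
           "4 * real k ^ 2 + 6 * real k + 1 = 4 * L - 2 * K - 1"
        by (simp_all add: L_def K_def power2_eq_square algebra_simps)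
      then have "lo1 k = (4 * L - 2 * K - 1) / (4 * L + 2 * K - 1)"
        unfolding lo1_eq by (simp only:)
      then show ?thesis using dpos by (simp add: field_simps)
    qed
    also have "\<dots> < 12 / 5 * ((4 * L - 2 * K - 1) / (4 * L))"
    proof -
      have "12 * ((4 * L - 2 * K - 1) * (4 * L + 2 * K - 1)) - 5 * ((8 * L - 2) * (4 * L))
          = 32 * (L * L) - 104 * L + 12"
        unfolding L_def by algebra
      moreover have "4 * L \<le> L * L" using L by (intro mult_right_mono) auto
      ultimately have "(8 * L - 2) * (4 * L) < 12 / 5 * ((4 * L - 2 * K - 1) * (4 * L + 2 * K - 1))"
        using L by linarith
      then have "(8 * L - 2) * (4 * L) < 12 / 5 * (4 * L - 2 * K - 1) * (4 * L + 2 * K - 1)"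
        by (simp only: mult.assoc)
      then have "(8 * L - 2) / (4 * L + 2 * K - 1) < 12 / 5 * (4 * L - 2 * K - 1) / (4 * L)"
        using L dpos by (subst frac_less_eq) (auto simp: divide_neg_pos)
      then show ?thesis by simp
    qed
    finally show ?thesis unfolding L_def .
  qed
  ultimately have Py: "1 + m < P * y" by linarith
  have cosy: "cos y > 0" using y y0 by (intro cos_gt_zero) auto
  have "y * cos y \<le> sin y"
    using tannum_pos[of y] y y0 pi_gt_zero by (auto simp: tannum_def)
  then have "P * (y * cos y) \<le> P * sin y"
    using z0 by (intro mult_left_mono) (auto simp: P_def)
  moreover have "(1 + m) * cos y < P * y * cos y"
    using Py cosy by (intro mult_strict_right_mono)
  ultimately have "(1 + m) * cos y < P * sin y" by (simp add: mult.assoc)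
  moreover have "z = pi / 2 - y" by (simp add: y_def)
  ultimately show "(1 + m) * sin z < (real k * pi + z) * cos z"
    unfolding P_def[symmetric] by (simp add: sin_diff cos_diff)
qed

lemma p2_below_line_interval:
  assumes "k \<ge> 1" "real k / (1 + real k) < m" "m \<le> lo1 k"
  shows "p2 m < pi * m / (1 - m)"
proof (rule p2_below_line[of m k])
  show "0 < m" using assms(2) by (meson divide_nonneg_nonneg le_less_trans of_nat_0_le_iff add_nonneg_nonneg zero_le_one)
  show "m < 1" using assms(3) lo1_hi1_less_1[of k] by simp
  define z where "z = pi * m / (1 - m) - real k * pi"
  note z = cosine_condition_below_lo1[OF assms, folded z_def]
  show "pi * m / (1 - m) = real k * pi + z" by (simp add: z_def)
  show "0 < z" "(1 + m) * sin z < (real k * pi + z) * cos z" by (rule z)+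
  show "z < pi" using z(2) pi_gt_zero by linarith
qed

lemma line_above_hi1:
  assumes "hi1 k \<le> m" "m < (1 + real k) / (2 + real k)"
  defines "z \<equiv> pi * m / (1 - m) - real k * pi"
  shows "0 < m" "m < 1" "pi / 2 \<le> z" "z < pi"
proof -
  show m0: "0 < m" using assms(1) by (rule less_le_trans[rotated]) (simp add: hi1_def)
  have "(1 + real k) / (2 + real k) < 1" by simp
  then show m1: "m < 1" using assms by linarith
  have "pi * hi1 k / (1 - hi1 k) \<le> pi * m / (1 - m)"
    using line_mono[of "hi1 k" m] assms m1 by (cases "m = hi1 k") auto
  then show "pi / 2 \<le> z" unfolding line_hi1 z_def by linarith
  have "pi * m / (1 - m) < pi * ((1 + real k) / (2 + real k)) / (1 - (1 + real k) / (2 + real k))"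
    using assms by (intro line_mono) auto
  also have "\<dots> = pi * (1 + real k)"
    by (subst line_at_ratio) auto
  finally show "z < pi" by (simp add: z_def algebra_simps)
qed

text \<open>Here z lies in [pi / 2, pi), so the cosine term is nonpositive and the sine term
  positive.\<close>

lemma p2_above_line_interval:
  assumes "hi1 k \<le> m" "m < (1 + real k) / (2 + real k)"
  shows "p2 m > pi * m / (1 - m)"
proof (rule p2_above_line[of m k])
  define z where "z = pi * m / (1 - m) - real k * pi"
  note z = line_above_hi1[OF assms, folded z_def]
  show "0 < m" "m < 1" "pi * m / (1 - m) = real k * pi + z" "z < pi"
    using z by (auto simp: z_def)
  show "0 < z" using z pi_gt_zero by linarith
  have "cos z \<le> 0" using z cos_monotone_0_pi_le[of "pi / 2" z] by simp
  moreover have "0 < sin z" using z \<open>0 < z\<close> by (intro sin_gt_zero)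
  ultimately have "(real k * pi + z) * cos z \<le> 0" "0 < (1 + m) * sin z"
    using z \<open>0 < z\<close> by (auto intro!: mult_nonneg_nonpos)
  then show "(real k * pi + z) * cos z < (1 + m) * sin z" by linarith
qed

section \<open>Roots of tan x = x and smoothness of \<open>p2\<close>\<close>

definition tan_branch :: "nat \<Rightarrow> real \<Rightarrow> real" where
  "tan_branch k z = sin z - (real k * pi + z) * cos z"

lemma tannum_branch: "tannum (real k * pi + z) = (-1) ^ k * tan_branch k z"
  by (simp add: tannum_def tan_branch_def sin_add cos_add algebra_simps)

lemma isCont_tan_branch: "isCont (tan_branch k) z"
  unfolding tan_branch_def by (intro continuous_intros)

text \<open>Stripping the sign (-1)^k from \<open>tannum\<close> makes every branch increasing on
  [0, pi], with derivative (k pi + z) sin z.\<close>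

lemma tan_branch_less:
  assumes "0 \<le> x" "x < y" "y \<le> pi"
  shows "tan_branch k x < tan_branch k y"
proof (rule DERIV_pos_imp_increasing_open[OF assms(2)])
  fix z assume z: "x < z" "z < y"
  have "(tan_branch k has_real_derivative (real k * pi + z) * sin z) (at z)"
    unfolding tan_branch_def by (rule derivative_eq_intros refl | simp)+
  moreover have "(real k * pi + z) * sin z > 0"
    using z assms by (intro mult_pos_pos sin_gt_zero add_nonneg_pos) auto
  ultimately show "\<exists>D. (tan_branch k has_real_derivative D) (at z) \<and> 0 < D" by blast
qed (auto intro: continuous_at_imp_continuous_on isCont_tan_branch)

lemma tan_branch_root_exists:
  assumes "k \<ge> 1"
  shows "\<exists>z. 0 < z \<and> z < pi / 2 \<and> tan_branch k z = 0"
proof -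
  have ends: "tan_branch k 0 < 0" "tan_branch k (pi / 2) = 1"
    using assms by (auto simp: tan_branch_def)
  then obtain z where z: "0 \<le> z" "z \<le> pi / 2" "tan_branch k z = 0"
    using IVT[of "tan_branch k" 0 0 "pi / 2"] isCont_tan_branch by auto
  moreover have "z \<noteq> 0" "z \<noteq> pi / 2" using ends z(3) by force+
  ultimately show ?thesis by (intro exI[of _ z]) auto
qed

lemma tannum_of_nat_pi: "k \<ge> 1 \<Longrightarrow> tannum (real k * pi) \<noteq> 0"
  using tannum_branch[of k 0] by (simp add: tan_branch_def)

lemma p2_less_next:
  assumes "0 < m" "m < (1 + real k) / (2 + real k)"
  shows "p2 m < real k * pi + pi"
proof -
  have "p2 m < p2 (real (Suc k) / (1 + real (Suc k)))"
    using assms by (intro p2_mono) auto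
  then show ?thesis using p2_at_ratio[of "Suc k"] by (simp add: algebra_simps)
qed

lemma less_p2_prev:
  assumes "k \<ge> 1" "real k / (1 + real k) < m" "m < 1"
  shows "real k * pi < p2 m"
  using p2_mono[of "real k / (1 + real k)" m] p2_at_ratio[OF assms(1)] assms by simp

lemma C1_at_p2_half:
  assumes "0 < m" "m < 1/2"
  shows "C1_at p2 m"
proof -
  have "p2 m < pi" using p2_less_next[of m 0] assms by simp
  then show ?thesis
    using C1_at_p2[of m] tannum_pos[of "p2 m"] p2_pos[of m] assms by simp
qed

lemma C1_at_p2_ratio:
  assumes "k \<ge> 1"
  shows "C1_at p2 (real k / (1 + real k))"
  using assms C1_at_p2[of "real k / (1 + real k)"] tannum_of_nat_pi[OF assms] p2_at_ratio[OF assms]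
  by simp

text \<open>The cosine condition makes \<open>tan_branch k\<close> negative at the curve point, and
  \<open>p2 m\<close> lies below that point, so \<open>p2 m\<close> has not reached the root of the
  branch. The left end point has \<open>p2 m\<close> = k pi and is treated apart.\<close>

lemma C1_at_p2_lo1:
  assumes k: "k \<ge> 1" and m: "real k / (1 + real k) \<le> m" "m \<le> lo1 k"
  shows "C1_at p2 m"
proof (cases "m = real k / (1 + real k)")
  case True
  then show ?thesis using C1_at_p2_ratio[OF k] by simp
next
  case False
  then have km: "real k / (1 + real k) < m" using m by simp
  have m01: "0 < m" "m < 1"
    using km m lo1_hi1_less_1[of k] by (auto intro: le_less_trans[of 0 "real k / (1 + real k)"])
  define z where "z = pi * m / (1 - m) - real k * pi"
  note z = cosine_condition_below_lo1[OF k km m(2), folded z_def]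
  define y where "y = p2 m - real k * pi"
  have "p2 m < real k * pi + z"
    using p2_below_line_interval[OF k km m(2)] by (simp add: z_def)
  then have "y < z" by (simp add: y_def)
  moreover have "0 < y" using less_p2_prev[OF k km m01(2)] by (simp add: y_def)
  ultimately have "tan_branch k y < tan_branch k z"
    using z pi_gt_zero by (intro tan_branch_less) auto
  also have "\<dots> < 0"
  proof -
    have "0 < m * sin z" using z m01 by (intro mult_pos_pos sin_gt_zero) auto
    then show ?thesis using z(3) unfolding tan_branch_def by (simp add: algebra_simps)
  qed
  finally have "tannum (real k * pi + y) \<noteq> 0" unfolding tannum_branch by simp
  then show ?thesis using C1_at_p2[OF m01] by (simp add: y_def)
qed

text \<open>Now \<open>p2 m\<close> lies beyond k pi + pi / 2, where the branch is already positive.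
  At the right end point \<open>p2 m\<close> = (k + 1) pi.\<close>

lemma C1_at_p2_hi1:
  assumes m: "hi1 k \<le> m" "m \<le> (1 + real k) / (2 + real k)"
  shows "C1_at p2 m"
proof (cases "m = (1 + real k) / (2 + real k)")
  case True
  then show ?thesis using C1_at_p2_ratio[of "Suc k"] by simp
next
  case False
  then have mk: "m < (1 + real k) / (2 + real k)" using m by simp
  note L = line_above_hi1[OF m(1) mk]
  define y where "y = p2 m - real k * pi"
  have y: "pi / 2 < y" "y < pi"
    using p2_above_line_interval[OF m(1) mk] L p2_less_next[OF L(1) mk] unfolding y_def by linarith+
  have "0 < sin y" using y pi_gt_zero by (intro sin_gt_zero) linarith+
  moreover have "(real k * pi + y) * cos y \<le> 0"
    using y cos_monotone_0_pi_le[of "pi / 2" y] pi_gt_zero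
    by (intro mult_nonneg_nonpos add_nonneg_nonneg) auto
  ultimately have "tan_branch k y > 0" unfolding tan_branch_def by linarith
  then have "tannum (real k * pi + y) \<noteq> 0" unfolding tannum_branch by simp
  then show ?thesis using C1_at_p2[OF L(1,2)] by (simp add: y_def)
qed

text \<open>The crossing a comes from the intermediate value theorem between \<open>lo1 k\<close>
  and \<open>hi1 k\<close>. The point b is the ratio at the root x of tan x = x in (k pi, k pi + pi
  / 2), so that \<open>p2 b\<close> = x is a critical point of \<open>succ_ratio\<close>.\<close>

lemma special_points:
  assumes k: "k \<ge> 1"
  shows "\<exists>a b. lo1 k < a \<and> a < b \<and> b < hi1 k \<and> p2 a = pi * a / (1 - a) \<and> has_deriv_pinfty p2 b"
proof -
  note r = ratio_lo1_hi1[of k]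
  have lo0: "0 < lo1 k" using r(1) by (rule le_less_trans[rotated]) simp
  let ?g = "\<lambda>m. p2 m - pi * m / (1 - m)"
  have "?g (lo1 k) < 0" using p2_below_line_interval[OF k r(1)] by simp
  moreover have "?g (hi1 k) > 0" using p2_above_line_interval[OF order_refl r(3)] by simp
  moreover have "\<forall>x. lo1 k \<le> x \<and> x \<le> hi1 k \<longrightarrow> isCont ?g x"
    using lo0 lo1_hi1_less_1[of k] by (auto intro!: continuous_intros isCont_p2)
  ultimately obtain a where a: "lo1 k \<le> a" "a \<le> hi1 k" "?g a = 0"
    using IVT[of ?g "lo1 k" 0 "hi1 k"] r(2) by (auto simp del: right_minus_eq)
  have "a \<noteq> lo1 k" "a \<noteq> hi1 k"
    using a(3) \<open>?g (lo1 k) < 0\<close> \<open>?g (hi1 k) > 0\<close> by auto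
  with a have a_in: "lo1 k < a" "a < hi1 k" by auto
  have a01: "0 < a" "a < 1" using a_in lo0 lo1_hi1_less_1[of k] by auto
  obtain w where w: "0 < w" "w < pi / 2" "tan_branch k w = 0"
    using tan_branch_root_exists[OF k] by blast
  define x where "x = real k * pi + w"
  define b where "b = succ_ratio x"
  have x0: "0 < x" using w by (simp add: x_def add_nonneg_pos)
  have b01: "0 < b" "b < 1" and p2b: "p2 b = x"
    using succ_ratio_bounds[OF x0] p2_succ_ratio[OF x0] by (auto simp: b_def)
  have "tannum (p2 b) = 0"
    unfolding p2b x_def tannum_branch w(3) by simp
  then have "has_deriv_pinfty p2 b" by (rule p2_deriv_pinfty[OF b01])
  moreover have "b < hi1 k"
  proof -
    have "x < p2 (hi1 k)"
      using p2_above_line_interval[OF order_refl r(3)] w unfolding line_hi1 x_def by simp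
    then show ?thesis
      using less_p2_iff[OF x0, of "hi1 k"] r lo0 lo1_hi1_less_1[of k] by (simp add: b_def)
  qed
  moreover have "a < b"
  proof -
    define z where "z = p2 a - real k * pi"
    have line: "pi * a / (1 - a) = real k * pi + z" using a(3) by (simp add: z_def)
    have "real k * pi < p2 a" by (rule less_p2_prev[OF k _ a01(2)]) (use a_in r in simp)
    moreover have "p2 a < real k * pi + pi" by (rule p2_less_next[OF a01(1)]) (use a_in r in simp)
    ultimately have z: "0 < z" "z < pi" by (auto simp: z_def)
    have sinz: "sin z > 0" using z by (rule sin_gt_zero)
    have "g2 (pi * a / (1 - a)) a = 0"
      using g2_p2[OF a01] a(3) by simp
    \<comment> \<open>A root on the curve makes the bracket in \<open>g2_on_line\<close> vanish.
      Then \<open>tan_branch k z\<close> = - a sin z < 0, so the crossing comes before the root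
      w.\<close>
    then have "(real k * pi + z) * cos z = (1 + a) * sin z"
      unfolding g2_on_line[OF a01 line] using a01 sinz by simp
    then have "tan_branch k z = - a * sin z"
      unfolding tan_branch_def by (simp add: algebra_simps)
    then have "tan_branch k z < tan_branch k w" using a01 sinz w by simp
    then have "z < w"
      using tan_branch_less[of w z k] z w by (cases z w rule: linorder_cases) auto
    then have "p2 a < x" by (simp add: z_def x_def)
    then show ?thesis using p2_less_iff[OF x0 a01] by (simp add: b_def)
  qed
  ultimately show ?thesis using a_in a(3) by (intro exI[of _ a] exI[of _ b]) auto
qed

subsection \<open>Explicit bounds\<close>

text \<open>Above: \<open>p2 m\<close> < pi, so its successor is below 2 pi. Below: at p = 5.7 m and
  q = 5.7 one has f p > 1/3 >= f q, which fixes the sign of \<open>g2\<close>.\<close>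

lemma p2_bounds_small:
  assumes m: "0 < m" "m < 1/2"
  shows "5.7 * m < p2 m" "p2 m < 2 * pi * m"
proof -
  have m1: "m < 1" using m by simp
  have x: "0 < p2 m" "p2 m < pi"
    using p2_pos[of m] p2_less_next[of m 0] m by simp_all
  note s = prufer_prufer_succ[OF x(1)]
  have "prufer (prufer_succ (p2 m)) < real 2 * pi"
    using prufer_less_of_nat_pi(1)[OF x(1), of 1] x s by simp
  then have "prufer_succ (p2 m) < 2 * pi"
    using prufer_less_of_nat_pi(1)[OF s(1), of 2] by simp
  moreover have "p2 m = m * prufer_succ (p2 m)"
    using succ_ratio_p2[OF m(1) m1] s(1) unfolding succ_ratio_def by (simp add: field_simps)
  ultimately show "p2 m < 2 * pi * m"
    using m(1) by (metis mult.commute mult_strict_left_mono)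
  define p q where "p = 5.7 * m" and "q = (5.7 :: real)"
  have pq: "p / m = q" "p = m * q" "0 < p" "p < pi"
    using m pi_gt3 by (auto simp: p_def q_def)
  \<comment> \<open>The claim for q becomes 17.1 cos y <= 29.49 sin y. The quotient 17.1 / 29.49 is
    just below 0.58, and pi >= 3.14 gives y >= 0.58.\<close>
  define y where "y = 2 * pi - q"
  have y: "0.58 \<le> y" "y < pi" using pi_lower pi_less_4 by (auto simp: y_def q_def)
  have sc: "sin q = - sin y" "cos q = cos y"
    by (simp_all add: y_def sin_diff cos_diff)
  have siny: "0 < sin y" using y by (intro sin_gt_zero) auto
  have "y * cos y < sin y" using tannum_pos[of y] y by (simp add: tannum_def)
  then have "0.58 * cos y \<le> sin y"
    using siny mult_right_mono[OF y(1), of "cos y"] by (cases "cos y \<ge> 0") auto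
  then have q: "q\<^sup>2 * sin q \<le> 3 * tannum q"
    unfolding tannum_def sc using siny by (simp add: q_def power2_eq_square)
  show "5.7 * m < p2 m"
    unfolding p_def[symmetric]
  proof (rule less_p2I[OF m(1) m1 pq(3)])
    have "p\<^sup>2 * sin p < 3 * tannum p" using tannum_bound_sin[of p] pq by simp
    then have "3 * tannum p * sin q < p\<^sup>2 * sin p * sin q"
      using siny sc by simp
    also have "\<dots> = m\<^sup>2 * sin p * (q\<^sup>2 * sin q)"
      unfolding pq(2) by (simp add: power2_eq_square)
    also have "\<dots> \<le> m\<^sup>2 * sin p * (3 * tannum q)"
      using q pq sin_gt_zero[of p] by (intro mult_left_mono) auto
    finally show "g2 p m < 0"
      using g2_tannum[of m p] m pq(1) by (simp add: algebra_simps)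
    have "prufer q < real 2 * pi"
      using prufer_less_of_nat_pi(1)[of q 2] pi_gt3 by (simp add: q_def)
    then show "prufer (p / m) < prufer p + 2 * pi"
      using prufer_pos[OF pq(3)] pq(1) by simp
  qed
qed

text \<open>Product-to-sum form: a trial point can prescribe p / m - p, while the terms in p / m + p
  are bounded by their amplitude through \<open>cos_add_mult_sin_bound\<close>.\<close>

lemma g2_sum_diff:
  "2 * g2 p m = (1 - m\<^sup>2) * (cos (p / m - p) - cos (p / m + p))
     - p * (1 - m) * sin (p / m + p) - p * (1 + m) * sin (p / m - p)"
  unfolding g2_def sin_add sin_diff cos_add cos_diff by (simp add: algebra_simps power2_eq_square)

lemma cos_add_mult_sin_bound:
  fixes A v :: real
  shows "\<bar>cos v + A * sin v\<bar> \<le> sqrt (1 + A\<^sup>2)"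
proof -
  have "(cos v + A * sin v)\<^sup>2 + (sin v - A * cos v)\<^sup>2 = 1 + A\<^sup>2"
    using sin_cos_squared_add[of v] by algebra
  then have "(cos v + A * sin v)\<^sup>2 \<le> 1 + A\<^sup>2"
    by (metis le_add_same_cancel1 zero_le_power2)
  then show ?thesis using real_le_rsqrt[of "\<bar>cos v + A * sin v\<bar>"] by simp
qed

lemma p2_lower_bound:
  assumes m: "1/2 \<le> m" "m < 1"
  shows "pi * m / (1 - m) - m / (1 - m) * arcsin ((1 - m) / (1 + m)) < p2 m"
proof -
  define s where "s = (1 - m) / (1 + m)"
  have s: "0 < s" "s \<le> 1/3" using m by (auto simp: s_def divide_simps)
  \<comment> \<open>The trial point p solves p / m - p = u. Since sin u = s, p (1 + m) sin u equals
    p (1 - m), the coefficient of the other sine.\<close>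
  define u where "u = pi - arcsin s"
  have u: "pi / 2 \<le> u" "u < pi"
    using s arcsin_bounded[of s] arcsin_less_arcsin[of 0 s] by (auto simp: u_def)
  define c where "c = sqrt (1 - s\<^sup>2)"
  have su: "sin u = s" "cos u = - c"
    using s by (auto simp: u_def c_def sin_diff cos_diff sin_arcsin cos_arcsin)
  define p where "p = m * u / (1 - m)"
  have p: "0 < p" "p / m = p + u"
    using m u pi_gt_zero by (auto simp: p_def field_simps intro: divide_pos_pos)
  define A where "A = p / (1 + m)"
  have ss: "s\<^sup>2 \<le> 1/9" using power_mono[OF s(2), of 2] s by (simp add: power2_eq_square)
  have "1/2 \<le> c"
    unfolding c_def by (rule real_le_rsqrt) (use ss in \<open>simp add: power2_eq_square\<close>)
  moreover have "c\<^sup>2 = 1 - s\<^sup>2" unfolding c_def using ss by simp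
  ultimately have c: "1/2 \<le> c" "c\<^sup>2 = 1 - s\<^sup>2" .
  have A: "1/2 \<le> A"
  proof -
    have "1/2 * (1 - m\<^sup>2) \<le> m" using m by (simp add: power2_eq_square) (smt (verit) zero_le_square)
    also have "m * 1 \<le> m * u" using m u pi_gt3 by (intro mult_left_mono) auto
    finally have "1/2 * ((1 - m) * (1 + m)) \<le> m * u" by (simp add: algebra_simps power2_eq_square)
    moreover have "0 < (1 - m) * (1 + m)" using m by simp
    ultimately have "1/2 \<le> m * u / ((1 - m) * (1 + m))"
      using pos_le_divide_eq by blast
    then show ?thesis by (simp add: A_def p_def)
  qed
  have "1/2 * (1/2) \<le> A * c" using A c by (intro mult_mono) auto
  \<comment> \<open>Expanded, this is s^2 < 2 A c, and s^2 <= 1/9 while A c >= 1/4.\<close>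
  then have "1 + A\<^sup>2 < (A + c)\<^sup>2"
    using ss c(2) by (simp add: power2_sum)
  then have "sqrt (1 + A\<^sup>2) < A + c"
    using A c by (intro real_less_lsqrt) auto
  then have "- c - A - (cos (p / m + p) + A * sin (p / m + p)) < 0"
    using cos_add_mult_sin_bound[of "p / m + p" A] by linarith
  moreover have "2 * g2 p m = (1 - m\<^sup>2) * (- c - A - (cos (p / m + p) + A * sin (p / m + p)))"
  proof -
    have "p * (1 - m) = (1 - m\<^sup>2) * A" "p * (1 + m) * s = (1 - m\<^sup>2) * A"
      using m by (simp_all add: A_def s_def field_simps power2_eq_square)
    moreover have diff: "p / m - p = u" using p by simp
    ultimately show ?thesis
      unfolding g2_sum_diff diff su by algebra
  qed
  moreover have "0 < 1 - m\<^sup>2" using m by (simp add: power_strict_mono abs_square_less_1)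
  ultimately have "g2 p m < 0" by (smt (verit) mult_pos_neg)
  then have "p < p2 m"
    using less_p2I[of m p] prufer_add_less_2pi[of p "p / m"] m p u by simp
  moreover have "p = pi * m / (1 - m) - m / (1 - m) * arcsin s"
    by (simp add: p_def u_def right_diff_distrib diff_divide_distrib mult.commute)
  ultimately show ?thesis by (simp add: s_def)
qed

lemma sin_lower:
  fixes x :: real
  assumes "0 \<le> x" "x \<le> pi"
  shows "x - x ^ 3 / 6 \<le> sin x"
proof -
  have cos_ge: "1 - y\<^sup>2 / 2 \<le> cos y" if "0 \<le> y" for y :: real
  proof -
    let ?F = "\<lambda>y::real. cos y - (1 - y\<^sup>2 / 2)"
    have "?F 0 \<le> ?F y"
    proof (rule DERIV_nonneg_imp_nondecreasing[OF that])
      fix z :: real assume "0 \<le> z"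
      then have "0 \<le> z - sin z" using sin_x_le_x[of z] by simp
      then show "\<exists>D. (?F has_real_derivative D) (at z) \<and> 0 \<le> D"
        by (intro exI[of _ "z - sin z"] conjI) (auto intro!: derivative_eq_intros)
    qed
    then show ?thesis by simp
  qed
  let ?F = "\<lambda>y::real. sin y - (y - y ^ 3 / 6)"
  have "?F 0 \<le> ?F x"
  proof (rule DERIV_nonneg_imp_nondecreasing[OF assms(1)])
    fix y :: real assume "0 \<le> y"
    then show "\<exists>D. (?F has_real_derivative D) (at y) \<and> 0 \<le> D"
      using cos_ge[of y]
      by (intro exI[of _ "cos y - (1 - y\<^sup>2 / 2)"] conjI) (auto intro!: derivative_eq_intros)
  qed
  then show ?thesis by simp
qed

text \<open>The trial point has p / m - p = pi + d. Positivity of \<open>g2\<close> reduces to B sin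
  d - cos d > sqrt (1 + A^2), which follows from B sin d > A + 3/2.\<close>

lemma p2_upper_bound:
  assumes m: "1/2 \<le> m" "m < 1"
  shows "p2 m < pi * m / (1 - m) + m / (3 * m - 1)"
proof -
  define t where "t = 3 * m - 1"
  have t: "1/2 \<le> t" "t < 2" using m by (auto simp: t_def)
  define d where "d = (1 - m) / t"
  have d: "0 < d" "d \<le> 1" using m t by (auto simp: d_def t_def)
  define u where "u = pi + d"
  have u: "3 < u" using d pi_gt3 by (simp add: u_def)
  define p where "p = m * u / (1 - m)"
  have p: "0 < p" "p / m = p + u"
    using m u by (auto simp: p_def field_simps intro: divide_pos_pos)
  define A B where "A = p / (1 + m)" and "B = p / (1 - m)"
  \<comment> \<open>After A is split off from B d, the remainder is a multiple of R, and so is the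
    cubic correction B d^3 / 6.\<close>
  define R where "R = m * u / t"
  have pos: "0 < 1 - m" "0 < 1 + m" "0 < t" "0 < m * u" using m t u by auto
  have A: "2 \<le> A"
  proof -
    have "2 * ((1 - m) * (1 + m)) \<le> m * 3"
    proof -
      have "0 \<le> (2 * m - 1) * (m + 2)" using m by (intro mult_nonneg_nonneg) auto
      then show ?thesis by (simp add: algebra_simps)
    qed
    also have "\<dots> \<le> m * u" using m u by (intro mult_left_mono) auto
    finally have "2 * ((1 - m) * (1 + m)) \<le> m * u" .
    moreover have "0 < (1 - m) * (1 + m)" using m by simp
    ultimately have "2 \<le> m * u / ((1 - m) * (1 + m))"
      using pos_le_divide_eq by blast
    then show ?thesis by (simp add: A_def p_def)
  qed
  have B: "0 < B" using p m by (simp add: B_def)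
  have "B * d = A + R * (2 * (1 - m) / ((1 + m) * (1 - m)))"
  proof -
    have "B * d = m * u / ((1 - m) * t)" using pos by (simp add: B_def p_def d_def)
    moreover have "A = m * u / ((1 - m) * (1 + m))" using pos by (simp add: A_def p_def)
    moreover have "X / (a * t) = X / (a * b) + X / t * ((b - t) / (b * a))"
      if "a \<noteq> 0" "b \<noteq> 0" "t \<noteq> 0" for X a b t :: real
      using that by (simp add: field_simps)
    moreover have "1 + m - t = 2 * (1 - m)" by (simp add: t_def)
    ultimately show ?thesis unfolding R_def
      using pos by (metis less_irrefl)
  qed
  moreover have "2 * (1 - m) / ((1 + m) * (1 - m)) = 2 / (1 + m)"
    using pos by (intro nonzero_mult_divide_mult_cancel_right) simp
  ultimately have Bd: "B * d = A + R * (2 / (1 + m))" by (simp only:)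
  have Bd3: "B * (d ^ 3 / 6) = R * ((1 - m) / (6 * t\<^sup>2))"
  proof -
    have "X / a / a * ((a / t) ^ 3 / 6) = X / t * (a / (6 * t\<^sup>2))"
      if "a \<noteq> 0" for X a :: real
      using that pos by (simp add: field_simps power2_eq_square power3_eq_cube)
    then show ?thesis unfolding B_def p_def d_def R_def using pos by simp
  qed
  \<comment> \<open>This amounts to 6 t^2 >= 1 + m, which t^2 >= t - 1/4 yields for m >=
    1/2.\<close>
  have "1 \<le> 2 / (1 + m) - (1 - m) / (6 * t\<^sup>2)"
  proof -
    have "(1/2)\<^sup>2 + 0 \<le> t\<^sup>2 - (t - 1/2)" using mult_nonneg_nonneg[of "t - 1/2" "t - 1/2"] t
      by (simp add: power2_eq_square algebra_simps)
    then have "1 + m \<le> 6 * t\<^sup>2" using t unfolding t_def by (simp add: power2_eq_square)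
    then have "(1 - m) / (6 * t\<^sup>2) \<le> (1 - m) / (1 + m)"
      using pos by (intro divide_left_mono) auto
    moreover have "2 / (1 + m) - (1 - m) / (1 + m) = 1"
      using pos by (simp add: diff_divide_distrib[symmetric])
    ultimately show ?thesis by linarith
  qed
  moreover have R: "3/2 < R"
  proof -
    have "3/2 * t \<le> m * 3" using m by (simp add: t_def)
    also have "m * 3 < m * u" using m u by (intro mult_strict_left_mono) auto
    finally show ?thesis using pos by (simp add: R_def field_simps)
  qed
  ultimately have "R * 1 \<le> R * (2 / (1 + m) - (1 - m) / (6 * t\<^sup>2))"
    by (intro mult_left_mono) auto
  then have "A + 3/2 < B * (d - d ^ 3 / 6)"
    using R Bd Bd3 unfolding right_diff_distrib by linarith
  also have "\<dots> \<le> B * sin d"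
    using B d pi_gt3 sin_lower[of d] by (intro mult_left_mono) auto
  finally have "A + 1/2 < B * sin d - cos d" using cos_le_one[of d] by linarith
  moreover have "sqrt (1 + A\<^sup>2) \<le> A + 1/2"
    using A by (intro real_le_lsqrt) (auto simp: power2_eq_square algebra_simps)
  ultimately have "0 < - cos d + B * sin d - (cos (p / m + p) + A * sin (p / m + p))"
    using cos_add_mult_sin_bound[of "p / m + p" A] by linarith
  moreover have "2 * g2 p m =
      (1 - m\<^sup>2) * (- cos d + B * sin d - (cos (p / m + p) + A * sin (p / m + p)))"
  proof -
    have "p * (1 - m) = (1 - m\<^sup>2) * A" "p * (1 + m) = (1 - m\<^sup>2) * B"
      using m by (simp_all add: A_def B_def field_simps power2_eq_square)
    moreover have "sin u = - sin d" "cos u = - cos d" by (simp_all add: u_def)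
    moreover have diff: "p / m - p = u" using p(2) by simp
    ultimately show ?thesis
      unfolding g2_sum_diff diff by algebra
  qed
  moreover have "0 < 1 - m\<^sup>2" using m by (simp add: power_strict_mono abs_square_less_1)
  ultimately have "0 < g2 p m" by (smt (verit) mult_pos_pos)
  then have "p2 m < p" using p2_lessI[of m p] m p by simp
  also have "p = pi * m / (1 - m) + m * d / (1 - m)"
    by (simp add: p_def u_def distrib_left add_divide_distrib mult.commute)
  also have "m * d / (1 - m) = m / (3 * m - 1)"
    using pos by (simp add: d_def t_def)
  finally show ?thesis .
qed

subsection \<open>Reflection \<open>m \<mapsto> 1 / m\<close>\<close>

lemma g2_reflect: "m \<noteq> 0 \<Longrightarrow> g2 p m = - m\<^sup>2 * g2 (p / m) (1 / m)"
  unfolding g2_def by (simp add: field_simps power2_eq_square)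

text \<open>Scaling by m carries the positive roots for 1 / m to those for m in the same order, and
  the factor - m^2 reverses the sign pattern.\<close>

lemma p2_reflect:
  assumes "m > 1"
  shows "p2 m = m * p2 (1 / m)" "p2 m > 0" "g2 (p2 m) m = 0"
    "\<And>p. 0 < p \<Longrightarrow> p < p2 m \<Longrightarrow> g2 p m > 0"
    "\<exists>e>0. \<forall>p\<in>{p2 m<..<p2 m + e}. g2 p m < 0"
proof -
  define n where "n = 1 / m"
  have n: "0 < n" "n < 1" using assms by (auto simp: n_def)
  have refl: "g2 p m = - m\<^sup>2 * g2 (p / m) n" for p
    using g2_reflect[of m p] assms by (simp add: n_def)
  have below: "g2 p m > 0" if "0 < p" "p < m * p2 n" for p
  proof -
    have "g2 (p / m) n < 0"
      using that assms by (intro g2_neg_below_p2[OF n]) (auto simp: field_simps)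
    then show ?thesis using assms unfolding refl by (simp add: mult_pos_neg)
  qed
  have root: "m * p2 n > 0" "g2 (m * p2 n) m = 0"
    using p2_pos[OF n] g2_p2[OF n] assms unfolding refl by auto
  show p2: "p2 m = m * p2 (1 / m)"
    unfolding n_def[symmetric] p2_def[of m]
  proof (rule Least_equality)
    show "0 < m * p2 n \<and> g2 (m * p2 n) m = 0" using root by blast
    show "m * p2 n \<le> p" if "0 < p \<and> g2 p m = 0" for p
      using below[of p] that by (metis less_irrefl not_less)
  qed
  note p2n = p2[folded n_def]
  show "p2 m > 0" "g2 (p2 m) m = 0" using root p2n by auto
  show "\<And>p. 0 < p \<Longrightarrow> p < p2 m \<Longrightarrow> g2 p m > 0" using below p2n by auto
  obtain e where e: "e > 0" "\<And>p. p \<in> {p2 n<..<p2 n + e} \<Longrightarrow> g2 p n > 0"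
    using g2_pos_above_p2[OF n] by blast
  have "g2 p m < 0" if "p \<in> {p2 m<..<p2 m + m * e}" for p
  proof -
    have "g2 (p / m) n > 0"
      using that assms by (intro e(2)) (auto simp: p2n field_simps)
    then show ?thesis using assms unfolding refl by simp
  qed
  then show "\<exists>e>0. \<forall>p\<in>{p2 m<..<p2 m + e}. g2 p m < 0"
    using e(1) assms by (intro exI[of _ "m * e"]) auto
qed

lemma isCont_p2_gt1:
  assumes "m > 1"
  shows "isCont p2 m"
proof -
  have "isCont (\<lambda>x. x * p2 (1 / x)) m"
    using assms by (intro continuous_intros isCont_o2[of _ "\<lambda>x. 1 / x" p2] isCont_p2) auto
  moreover have "eventually (\<lambda>x. p2 x = x * p2 (1 / x)) (nhds m)"
    using eventually_nhds_in_open[of "{1<..}" m] assms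
    by (auto elim!: eventually_mono intro: p2_reflect(1))
  ultimately show ?thesis using isCont_cong by fast
qed

lemma C1_at_p2_reflect:
  assumes m: "m > 1" and C1: "C1_at p2 (1 / m)"
  shows "C1_at p2 m"
proof -
  obtain U D where U: "open U" "1 / m \<in> U"
    "\<And>x. x \<in> U \<Longrightarrow> (p2 has_real_derivative D x) (at x)" "continuous_on U D"
    using C1 unfolding C1_at_def C1_differentiable_on_def
    by (auto simp: has_real_derivative_iff_has_vector_derivative)
  define V where "V = {1<..} \<inter> (\<lambda>x. 1 / x) -` U"
  have inv: "continuous_on {1<..} (\<lambda>x::real. 1 / x)"
    by (intro continuous_intros) auto
  then have V: "open V" unfolding V_def by (intro continuous_open_preimage U) auto
  have der: "(p2 has_real_derivative p2 (1 / x) - D (1 / x) / x) (at x)" if x: "x \<in> V" for x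
  proof -
    have x1: "x > 1" "1 / x \<in> U" using x by (auto simp: V_def)
    have "((\<lambda>x. 1 / x) has_real_derivative - 1 / x\<^sup>2) (at x)"
      using x1 by (auto intro!: derivative_eq_intros simp: power2_eq_square)
    then have "((\<lambda>x. p2 (1 / x)) has_real_derivative D (1 / x) * (- 1 / x\<^sup>2)) (at x)"
      by (rule DERIV_chain2[of p2 _ "\<lambda>x. 1 / x", OF U(3)[OF x1(2)]])
    then have "((\<lambda>x. x * p2 (1 / x)) has_real_derivative
        1 * p2 (1 / x) + D (1 / x) * (- 1 / x\<^sup>2) * x) (at x)"
      by (intro DERIV_mult DERIV_ident)
    moreover have "1 * p2 (1 / x) + D (1 / x) * (- 1 / x\<^sup>2) * x = p2 (1 / x) - D (1 / x) / x"
      using x1 by (simp add: power2_eq_square)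
    ultimately have "((\<lambda>x. x * p2 (1 / x)) has_real_derivative p2 (1 / x) - D (1 / x) / x) (at x)"
      by simp
    then show ?thesis
      by (rule has_field_derivative_transform_within_open[OF _ V x])
         (simp add: V_def p2_reflect(1))
  qed
  have "continuous_on V (\<lambda>x. 1 / x)" using inv by (rule continuous_on_subset) (auto simp: V_def)
  moreover have "continuous_on U p2"
    using U(1,3) by (intro continuous_at_imp_continuous_on) (auto intro: DERIV_isCont)
  ultimately have "continuous_on V (\<lambda>x. p2 (1 / x) - D (1 / x) / x)"
    using U(4)
    by (intro continuous_intros continuous_on_compose2[of U p2 V] continuous_on_compose2[of U D V])
       (auto simp: V_def)
  then show ?thesis
    unfolding C1_at_def C1_differentiable_on_def using V der m U(2)
    by (intro exI[of _ V] conjI exI[of _ "\<lambda>x. p2 (1 / x) - D (1 / x) / x"])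
       (auto simp: V_def has_real_derivative_iff_has_vector_derivative)
qed

text \<open>With M = 1 / m, the difference quotient at M is exactly \<open>p2 m\<close> minus 1 / M
  times the quotient at m for the increment \<open>r h\<close>, and \<open>r h\<close> tends to 0
  without vanishing.\<close>

lemma p2_deriv_minfty_reflect:
  assumes m: "0 < m" "m < 1" and top: "has_deriv_pinfty p2 m"
  shows "has_deriv_minfty p2 (1 / m)"
proof -
  define M where "M = 1 / m"
  have M: "1 < M" "m = 1 / M" using m by (auto simp: M_def)
  define r where "r h = 1 / (M + h) - m" for h
  have ev: "eventually (\<lambda>h. h \<noteq> 0 \<and> 1 < M + h) (at 0)"
  proof (intro eventually_conj)
    show "eventually (\<lambda>h::real. h \<noteq> 0) (at 0)" by (simp add: eventually_at_filter)
    have "((\<lambda>h. M + h) \<longlongrightarrow> M + 0) (at 0)" by (intro tendsto_intros)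
    then show "eventually (\<lambda>h. 1 < M + h) (at 0)" using M by (intro order_tendstoD) auto
  qed
  have "filterlim r (at 0) (at 0)"
  proof (rule filterlim_atI)
    have "(r \<longlongrightarrow> 1 / (M + 0) - m) (at 0)"
      unfolding r_def using M by (intro tendsto_intros) auto
    then show "(r \<longlongrightarrow> 0) (at 0)" using M by simp
    from ev show "eventually (\<lambda>h. r h \<noteq> 0) (at 0)"
      by eventually_elim (use M in \<open>auto simp: r_def field_simps\<close>)
  qed
  then have "filterlim (\<lambda>h. (p2 (m + r h) - p2 m) / r h) at_top (at 0)"
    using filterlim_compose[OF top[unfolded has_deriv_pinfty_def]] by blast
  then have "filterlim (\<lambda>h. (1 / M) * ((p2 (m + r h) - p2 m) / r h)) at_top (at 0)"
    using M by (intro filterlim_tendsto_pos_mult_at_top[OF tendsto_const]) auto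
  then have "filterlim (\<lambda>h. - p2 m + (1 / M) * ((p2 (m + r h) - p2 m) / r h)) at_top (at 0)"
    by (rule filterlim_tendsto_add_at_top[OF tendsto_const])
  then have bot: "filterlim (\<lambda>h. - (- p2 m + (1 / M) * ((p2 (m + r h) - p2 m) / r h))) at_bot (at 0)"
    by (simp only: filterlim_uminus_at_bot minus_minus)
  show ?thesis
    unfolding has_deriv_minfty_def M_def[symmetric]
  proof (rule filterlim_mono_eventually[OF bot order_refl order_refl])
    from ev show "eventually (\<lambda>h. - (- p2 m + (1 / M) * ((p2 (m + r h) - p2 m) / r h))
        = (p2 (M + h) - p2 M) / h) (at 0)"
    proof eventually_elim
      case (elim h)
      then have h: "h \<noteq> 0" "1 < M + h" by auto
      have r: "r h = - h / (M * (M + h))"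
        using M h unfolding r_def M(2) by (simp add: field_simps)
      define a b where "a = p2 (m + r h)" and "b = p2 m"
      have "p2 (M + h) = (M + h) * a"
        using p2_reflect(1)[OF h(2)] by (simp add: a_def r_def)
      moreover have "p2 M = M * b"
        using p2_reflect(1)[OF M(1)] by (simp add: b_def M(2))
      moreover have "(1 / M) * ((a - b) / r h) = - ((M + h) * (a - b) / h)"
        unfolding r using M h by (simp add: field_simps)
      moreover have "- (- b + - ((M + h) * (a - b) / h)) = ((M + h) * a - M * b) / h"
        using h(1) by (simp add: field_simps)
      ultimately show ?case unfolding a_def[symmetric] b_def[symmetric] by simp
    qed
  qed
qed

lemma C1_at_quotient_tendsto:
  assumes "C1_at f x"
  obtains D where "((\<lambda>h. (f (x + h) - f x) / h) \<longlongrightarrow> D) (at 0)"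
proof -
  obtain D where "(f has_real_derivative D) (at x)"
    using assms unfolding C1_at_def C1_differentiable_on_def
    by (auto simp: has_real_derivative_iff_has_vector_derivative)
  then show ?thesis using that unfolding DERIV_def by blast
qed

text \<open>Keeps the points with infinite derivative out of \<open>smooth_set\<close>, where the
  quotients have finite limits.\<close>

lemma not_C1_at_pinfty: "has_deriv_pinfty f x \<Longrightarrow> \<not> C1_at f x"
  and not_C1_at_minfty: "has_deriv_minfty f x \<Longrightarrow> \<not> C1_at f x"
proof -
  have "\<not> C1_at f x" if "filterlim (\<lambda>h. (f (x + h) - f x) / h) at_infinity (at 0)"
    using not_tendsto_and_filterlim_at_infinity[OF at_neq_bot _ that] C1_at_quotient_tendsto
    by blast
  then show "has_deriv_pinfty f x \<Longrightarrow> \<not> C1_at f x" "has_deriv_minfty f x \<Longrightarrow> \<not> C1_at f x"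
    unfolding has_deriv_pinfty_def has_deriv_minfty_def
    by (auto dest: filterlim_at_top_imp_at_infinity filterlim_at_bot_imp_at_infinity)
qed

text \<open>The reciprocal of \<open>lo1 k\<close> is \<open>lo2 k\<close> + 2 / (e f), and e f
  exceeds the denominator in \<open>hi2\<close> by 16 k^2. So the intervals starting at
  \<open>hi2 k\<close> reflect into those ending at \<open>lo1 k\<close>.\<close>

lemma inverse_lo1_le_hi2:
  assumes "k \<ge> 1"
  shows "1 / lo1 k \<le> hi2 k"
proof -
  let ?k = "real k"
  define e f g where "e = 4 * ?k ^ 2 + 6 * ?k + 1" and "f = 1 + 2 * ?k"
    and "g = 1 + 8 * ?k * (1 + ?k ^ 2)"
  have pos: "e > 0" "f > 0" "g > 0" by (simp_all add: e_def f_def g_def add_nonneg_pos add_pos_nonneg)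
  have "(4 * ?k ^ 2 + 10 * ?k + 5) * f = (3 + 2 * ?k) * e + 2"
    unfolding e_def f_def by algebra
  then have "1 / lo1 k = (3 + 2 * ?k) / f + 2 / (e * f)"
    using pos unfolding lo1_eq e_def[symmetric] by (simp add: field_simps)
  moreover have "e * f - g = 16 * ?k ^ 2"
    unfolding e_def f_def g_def by algebra
  then have "g \<le> e * f" using zero_le_power2[of ?k] by linarith
  then have "2 / (e * f) \<le> 2 / g" using pos by (intro divide_left_mono) auto
  ultimately show ?thesis unfolding hi2_def f_def[symmetric] g_def[symmetric] by simp
qed

lemma hi1_lo2: "1 / hi1 k = lo2 k"
  unfolding hi1_def lo2_def by simp

lemma lo1_pos: "0 < lo1 k"
  using ratio_lo1_hi1(1)[of k] by (rule le_less_trans[rotated]) simp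

lemma inverse_le: "0 < a \<Longrightarrow> 0 < m \<Longrightarrow> 1 / a \<le> m \<Longrightarrow> 1 / m \<le> a" for a m :: real
  by (simp add: field_simps)

lemma le_inverse: "0 < a \<Longrightarrow> 0 < m \<Longrightarrow> m \<le> 1 / a \<Longrightarrow> a \<le> 1 / m" for a m :: real
  by (simp add: field_simps)

lemma less_inverse: "0 < a \<Longrightarrow> 0 < m \<Longrightarrow> m < 1 / a \<Longrightarrow> a < 1 / m" for a m :: real
  by (simp add: field_simps)

lemma inverse_less: "0 < a \<Longrightarrow> 0 < m \<Longrightarrow> 1 / a < m \<Longrightarrow> 1 / m < a" for a m :: real
  by (simp add: field_simps)

lemma reflected_hi2_interval:
  assumes k: "k \<ge> 1" and m: "hi2 k \<le> m"
  shows "1 < m" "1 / m \<le> lo1 k"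
proof -
  have "1 < 1 / lo1 k" using lo1_pos[of k] lo1_hi1_less_1[of k] by simp
  then show m1: "1 < m" using inverse_lo1_le_hi2[OF k] m by linarith
  show "1 / m \<le> lo1 k"
    by (rule inverse_le) (use lo1_pos m1 inverse_lo1_le_hi2[OF k] m in auto)
qed

lemma reflected_lo2_interval:
  assumes k: "k \<ge> 1" and m: "m \<le> lo2 k" "0 < m"
  shows "hi1 k \<le> 1 / m"
  by (rule le_inverse) (use m in \<open>auto simp: hi1_lo2 hi1_def lo2_def\<close>)

lemma C1_at_p2_smooth_set:
  assumes "m \<in> smooth_set"
  shows "C1_at p2 m"
proof -
  have "0 < m \<and> m < 1/2 \<or> m > 2 \<or>
    (\<exists>k\<ge>1. (real k / (1 + real k) \<le> m \<and> m \<le> lo1 k) \<or>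
        (hi1 k \<le> m \<and> m \<le> (1 + real k) / (2 + real k)) \<or>
        ((real k + 2) / (real k + 1) \<le> m \<and> m \<le> lo2 k) \<or>
        (hi2 k \<le> m \<and> m \<le> (real k + 1) / real k))"
    using assms unfolding smooth_set_def by (simp only: Un_iff UN_iff atLeast_iff
      greaterThan_iff greaterThanLessThan_iff atLeastAtMost_iff) blast
  then consider "0 < m" "m < 1/2" | "m > 2"
    | k where "k \<ge> 1" "real k / (1 + real k) \<le> m" "m \<le> lo1 k"
    | k where "k \<ge> 1" "hi1 k \<le> m" "m \<le> (1 + real k) / (2 + real k)"
    | k where "k \<ge> 1" "(real k + 2) / (real k + 1) \<le> m" "m \<le> lo2 k"
    | k where "k \<ge> 1" "hi2 k \<le> m" "m \<le> (real k + 1) / real k"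
    by blast
  then show ?thesis
  proof cases
    case 1
    then show ?thesis by (rule C1_at_p2_half)
  next
    case 2
    then have "C1_at p2 (1 / m)" by (intro C1_at_p2_half) auto
    then show ?thesis using 2 by (intro C1_at_p2_reflect[of m]) auto
  next
    case 3
    then show ?thesis by (rule C1_at_p2_lo1)
  next
    case 4
    then show ?thesis by (intro C1_at_p2_hi1)
  next
    case 5
    have "1 < (real k + 2) / (real k + 1)" by simp
    then have m1: "1 < m" using 5 by linarith
    moreover have "1 / m \<le> (1 + real k) / (2 + real k)"
      by (rule inverse_le) (use 5 m1 in \<open>auto simp: add.commute\<close>)
    ultimately show ?thesis
      using C1_at_p2_reflect[OF m1] C1_at_p2_hi1[of k] reflected_lo2_interval[OF 5(1,3)] by simp
  next
    case 6
    note r = reflected_hi2_interval[OF 6(1,2)]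
    have "real k / (1 + real k) \<le> 1 / m"
      by (rule le_inverse) (use 6 r in \<open>auto simp: add.commute\<close>)
    then show ?thesis
      using C1_at_p2_reflect[OF r(1)] C1_at_p2_lo1[OF 6(1)] r(2) by blast
  qed
qed

text \<open>Inversion reverses the order, so for m > 1 the infinite derivative precedes the
  crossing.\<close>

lemma special_points_reflect:
  assumes k: "k \<ge> 1"
    and a: "lo1 k < a" "a < b" "b < hi1 k" "p2 a = pi * a / (1 - a)" "has_deriv_pinfty p2 b"
  shows "lo2 k < 1 / b" "1 / b < 1 / a" "1 / a < hi2 k"
    "p2 (1 / a) = pi * (1 / a) / (1 / a - 1)" "has_deriv_minfty p2 (1 / b)"
proof -
  have ab: "0 < a" "0 < b" "a < 1" "b < 1"
    using a lo1_pos[of k] lo1_hi1_less_1[of k] by auto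
  show "lo2 k < 1 / b" unfolding hi1_lo2[symmetric] using a ab by (intro divide_strict_left_mono) auto
  show "1 / b < 1 / a" using a ab by (intro divide_strict_left_mono) auto
  have "1 / a < 1 / lo1 k" using a ab lo1_pos[of k] by (intro divide_strict_left_mono) auto
  then show "1 / a < hi2 k" using inverse_lo1_le_hi2[OF k] by linarith
  have "p2 (1 / a) = 1 / a * p2 a"
    using p2_reflect(1)[of "1 / a"] ab by simp
  then show "p2 (1 / a) = pi * (1 / a) / (1 / a - 1)"
    unfolding a(4) using ab by (simp add: field_simps)
  show "has_deriv_minfty p2 (1 / b)" by (rule p2_deriv_minfty_reflect[OF ab(2,4) a(5)])
qed

section \<open>Collecting the statements for all m\<close>

lemma p2_least_root:
  assumes "m \<in> {0<..<1} \<union> {1<..}"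
  shows "p2 m > 0" "g2 (p2 m) m = 0" "\<And>p. 0 < p \<Longrightarrow> g2 p m = 0 \<Longrightarrow> p2 m \<le> p"
proof -
  have "p2 m > 0 \<and> g2 (p2 m) m = 0 \<and> (\<forall>p>0. g2 p m = 0 \<longrightarrow> p2 m \<le> p)"
  proof (cases "m < 1")
    case True
    then show ?thesis
      using assms p2_pos[of m] g2_p2[of m] g2_neg_below_p2[of m] by (force simp: not_le[symmetric])
  next
    case False
    then have "m > 1" using assms by auto
    then show ?thesis using p2_reflect[of m] by (force simp: not_le[symmetric])
  qed
  then show "p2 m > 0" "g2 (p2 m) m = 0" "\<And>p. 0 < p \<Longrightarrow> g2 p m = 0 \<Longrightarrow> p2 m \<le> p"
    by blast+
qed

lemma p2_changes_sign:
  assumes "m \<in> {0<..<1} \<union> {1<..}"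
  shows "changes_sign_at (\<lambda>p. g2 p m) (p2 m)"
proof (cases "m < 1")
  case True
  then have m: "0 < m" "m < 1" using assms by auto
  obtain e where e: "e > 0" "\<forall>p\<in>{p2 m<..<p2 m + e}. g2 p m > 0"
    using g2_pos_above_p2[OF m] by blast
  then show ?thesis
    unfolding changes_sign_at_def using p2_pos[OF m] g2_neg_below_p2[OF m]
    by (intro exI[of _ "min e (p2 m)"]) auto
next
  case False
  then have m: "m > 1" using assms by auto
  obtain e where e: "e > 0" "\<forall>p\<in>{p2 m<..<p2 m + e}. g2 p m < 0"
    using p2_reflect(5)[OF m] by blast
  then show ?thesis
    unfolding changes_sign_at_def using p2_reflect(2,4)[OF m]
    by (intro exI[of _ "min e (p2 m)"]) auto
qed

lemma line_reflect: "m > 1 \<Longrightarrow> m * (pi * (1 / m) / (1 - 1 / m)) = pi * m / (m - 1)" for m :: real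
  by (simp add: field_simps)

lemma p2_bounds_reflect:
  assumes m: "1 < m" "m \<le> 2"
  shows "pi * m / (m - 1) - m / (m - 1) * arcsin ((m - 1) / (m + 1)) < p2 m"
    and "p2 m < pi * m / (m - 1) + m / (3 - m)"
proof -
  define n where "n = 1 / m"
  have n: "1/2 \<le> n" "n < 1" using m by (auto simp: n_def)
  have p2: "p2 m = m * p2 n" using p2_reflect(1)[of m] m by (simp add: n_def)
  have line: "m * (pi * n / (1 - n)) = pi * m / (m - 1)"
    using line_reflect[of m] m by (simp add: n_def)
  have "1 - n = (m - 1) / m" "1 + n = (m + 1) / m" "3 * n - 1 = (3 - m) / m"
    using m by (simp_all add: n_def diff_divide_distrib add_divide_distrib)
  then have e: "m * (n / (1 - n)) = m / (m - 1)" "(1 - n) / (1 + n) = (m - 1) / (m + 1)"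
    "m * (n / (3 * n - 1)) = m / (3 - m)"
    using m by (simp_all add: n_def)
  have "m * (pi * n / (1 - n) - n / (1 - n) * arcsin ((1 - n) / (1 + n))) < p2 m"
    unfolding p2 using p2_lower_bound[OF n] m by (intro mult_strict_left_mono) auto
  also have "m * (pi * n / (1 - n) - n / (1 - n) * arcsin ((1 - n) / (1 + n)))
      = m * (pi * n / (1 - n)) - m * (n / (1 - n)) * arcsin ((1 - n) / (1 + n))"
    by (simp only: right_diff_distrib mult.assoc)
  also have "\<dots> = pi * m / (m - 1) - m / (m - 1) * arcsin ((m - 1) / (m + 1))"
    by (simp only: line e)
  finally show "pi * m / (m - 1) - m / (m - 1) * arcsin ((m - 1) / (m + 1)) < p2 m" .
  have "p2 m < m * (pi * n / (1 - n) + n / (3 * n - 1))"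
    unfolding p2 using p2_upper_bound[OF n] m by (intro mult_strict_left_mono) auto
  then show "p2 m < pi * m / (m - 1) + m / (3 - m)"
    by (simp only: distrib_left line e)
qed

lemma p2_bounds_large:
  assumes "m > 2"
  shows "5.7 < p2 m" "p2 m < 2 * pi"
proof -
  have "5.7 * (1 / m) < p2 (1 / m)" "p2 (1 / m) < 2 * pi * (1 / m)"
    using p2_bounds_small[of "1 / m"] assms by auto
  then show "5.7 < p2 m" "p2 m < 2 * pi"
    using p2_reflect(1)[of m] assms by (simp_all add: field_simps)
qed

lemma p2_at_ratio_values:
  assumes "k \<ge> 1"
  shows "let m = real k / (real k + 1) in p2 m = pi * m / (1 - m)"
    and "let m = (real k + 1) / real k in p2 m = pi * m / (m - 1)"
proof -
  have "p2 (real k / (real k + 1)) = real k * pi"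
    using p2_at_ratio[OF assms] by (simp add: add.commute)
  moreover from this have "p2 ((real k + 1) / real k) = (real k + 1) / real k * (real k * pi)"
    using p2_reflect(1)[of "(real k + 1) / real k"] assms by simp
  ultimately show "let m = real k / (real k + 1) in p2 m = pi * m / (1 - m)"
    "let m = (real k + 1) / real k in p2 m = pi * m / (m - 1)"
    using assms by (simp_all add: Let_def field_simps)
qed

lemma p2_line_reflect:
  assumes "m > 1"
  shows "p2 (1 / m) < pi * (1 / m) / (1 - 1 / m) \<Longrightarrow> p2 m < pi * m / (m - 1)"
    and "p2 (1 / m) > pi * (1 / m) / (1 - 1 / m) \<Longrightarrow> p2 m > pi * m / (m - 1)"
  unfolding p2_reflect(1)[OF assms] line_reflect[OF assms, symmetric]
  using assms by (auto intro: mult_strict_left_mono simp del: times_divide_eq_right)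

lemma p2_above_line_lo2:
  assumes k: "k \<ge> 1" and m: "(real k + 2) / (real k + 1) < m" "m \<le> lo2 k"
  shows "p2 m > pi * m / (m - 1)"
proof -
  have "1 < (real k + 2) / (real k + 1)" by simp
  then have m1: "1 < m" using m by linarith
  have "1 / m < (1 + real k) / (2 + real k)"
    by (rule inverse_less) (use m m1 in \<open>auto simp: add.commute\<close>)
  then show ?thesis
    using reflected_lo2_interval[OF k m(2)] m1
    by (intro p2_line_reflect p2_above_line_interval) auto
qed

lemma p2_below_line_hi2:
  assumes k: "k \<ge> 1" and m: "hi2 k \<le> m" "m < (real k + 1) / real k"
  shows "p2 m < pi * m / (m - 1)"
proof -
  note r = reflected_hi2_interval[OF k m(1)]
  have "real k / (1 + real k) < 1 / m"
    by (rule less_inverse) (use k m r in \<open>auto simp: add.commute\<close>)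
  then show ?thesis
    using r k by (intro p2_line_reflect p2_below_line_interval[of k]) auto
qed

theorem theorem5p1:
  shows
    "(\<forall>m::real. m \<in> {0<..<1} \<union> {1<..} \<longrightarrow>
        p2 m > 0 \<and> g2 (p2 m) m = 0 \<and> (\<forall>p>0. g2 p m = 0 \<longrightarrow> p2 m \<le> p))
   \<and> continuous_on {0<..<1} p2
   \<and> continuous_on {1<..} p2
   \<and> (\<forall>k::nat. k \<ge> 1 \<longrightarrow>
        (let m = real k / (real k + 1) in p2 m = pi * m / (1 - m)) \<and>
        (let m = (real k + 1) / real k in p2 m = pi * m / (m - 1)))
   \<and> (\<forall>m\<in>smooth_set. C1_at p2 m)
   \<and> (\<exists>mstar1 mstar2 mbar1 mbar2 :: nat \<Rightarrow> real. \<forall>k\<ge>1.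
        lo1 k < mstar1 k \<and> mstar1 k < mbar1 k \<and> mbar1 k < hi1 k \<and>
        lo2 k < mbar2 k \<and> mbar2 k < mstar2 k \<and> mstar2 k < hi2 k \<and>
        p2 (mstar1 k) = pi * mstar1 k / (1 - mstar1 k) \<and>
        p2 (mstar2 k) = pi * mstar2 k / (mstar2 k - 1) \<and>
        mbar1 k \<notin> smooth_set \<and> mbar2 k \<notin> smooth_set \<and>
        has_deriv_pinfty p2 (mbar1 k) \<and> has_deriv_minfty p2 (mbar2 k))
   \<and> (\<forall>m::real. 0 < m \<and> m < 1/2 \<longrightarrow> 5.7 * m < p2 m \<and> p2 m < 2 * pi * m)
   \<and> (\<forall>m::real. 1/2 \<le> m \<and> m < 1 \<longrightarrow>
        pi * m / (1 - m) - m / (1 - m) * arcsin ((1 - m) / (1 + m)) < p2 m \<and>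
        p2 m < pi * m / (1 - m) + m / (3 * m - 1))
   \<and> (\<forall>m::real. 1 < m \<and> m \<le> 2 \<longrightarrow>
        pi * m / (m - 1) - m / (m - 1) * arcsin ((m - 1) / (m + 1)) < p2 m \<and>
        p2 m < pi * m / (m - 1) + m / (3 - m))
   \<and> (\<forall>m::real. m > 2 \<longrightarrow> 5.7 < p2 m \<and> p2 m < 2 * pi)
   \<and> (\<forall>k::nat. k \<ge> 1 \<longrightarrow>
        (\<forall>m\<in>{real k / (1 + real k) <.. lo1 k}. p2 m < pi * m / (1 - m)) \<and>
        (\<forall>m\<in>{hi1 k ..< (1 + real k) / (2 + real k)}. p2 m > pi * m / (1 - m)) \<and>
        (\<forall>m\<in>{(real k + 2) / (real k + 1) <.. lo2 k}. p2 m > pi * m / (m - 1)) \<and>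
        (\<forall>m\<in>{hi2 k ..< (real k + 1) / real k}. p2 m < pi * m / (m - 1)))
   \<and> (\<forall>m::real. m \<in> {0<..<1} \<union> {1<..} \<longrightarrow> changes_sign_at (\<lambda>p. g2 p m) (p2 m))"
proof -
  obtain a b where ab: "\<And>k. k \<ge> 1 \<Longrightarrow> lo1 k < a k \<and> a k < b k \<and> b k < hi1 k \<and>
      p2 (a k) = pi * a k / (1 - a k) \<and> has_deriv_pinfty p2 (b k)"
    using special_points by metis
  have special: "\<exists>mstar1 mstar2 mbar1 mbar2 :: nat \<Rightarrow> real. \<forall>k\<ge>1.
        lo1 k < mstar1 k \<and> mstar1 k < mbar1 k \<and> mbar1 k < hi1 k \<and>
        lo2 k < mbar2 k \<and> mbar2 k < mstar2 k \<and> mstar2 k < hi2 k \<and>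
        p2 (mstar1 k) = pi * mstar1 k / (1 - mstar1 k) \<and>
        p2 (mstar2 k) = pi * mstar2 k / (mstar2 k - 1) \<and>
        mbar1 k \<notin> smooth_set \<and> mbar2 k \<notin> smooth_set \<and>
        has_deriv_pinfty p2 (mbar1 k) \<and> has_deriv_minfty p2 (mbar2 k)"
  \<comment> \<open>For m > 1 the witnesses are the reciprocals of those for m < 1.\<close>
  proof (rule exI[of _ a], rule exI[of _ "\<lambda>k. 1 / a k"], rule exI[of _ b],
      rule exI[of _ "\<lambda>k. 1 / b k"], intro allI impI)
    fix k :: nat assume k: "k \<ge> 1"
    have refl: "lo2 k < 1 / b k" "1 / b k < 1 / a k" "1 / a k < hi2 k"
      "p2 (1 / a k) = pi * (1 / a k) / (1 / a k - 1)" "has_deriv_minfty p2 (1 / b k)"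
      using special_points_reflect[OF k, of "a k" "b k"] ab[OF k] by blast+
    have "b k \<notin> smooth_set" "1 / b k \<notin> smooth_set"
      using C1_at_p2_smooth_set not_C1_at_pinfty not_C1_at_minfty ab[OF k] refl(5) by blast+
    then show "lo1 k < a k \<and> a k < b k \<and> b k < hi1 k \<and>
        lo2 k < 1 / b k \<and> 1 / b k < 1 / a k \<and> 1 / a k < hi2 k \<and>
        p2 (a k) = pi * a k / (1 - a k) \<and> p2 (1 / a k) = pi * (1 / a k) / (1 / a k - 1) \<and>
        b k \<notin> smooth_set \<and> 1 / b k \<notin> smooth_set \<and>
        has_deriv_pinfty p2 (b k) \<and> has_deriv_minfty p2 (1 / b k)"
      using ab[OF k] refl by blast
  qed
  have cont: "continuous_on {0<..<1} p2" "continuous_on {1<..} p2"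
    by (intro continuous_at_imp_continuous_on ballI; simp add: isCont_p2 isCont_p2_gt1)+
  show ?thesis
    by (intro conjI allI impI ballI special cont;
        (simp only: atLeastLessThan_iff greaterThanAtMost_iff)?; (elim conjE)?;
        rule p2_least_root p2_at_ratio_values C1_at_p2_smooth_set p2_bounds_small p2_lower_bound
          p2_upper_bound p2_bounds_reflect p2_bounds_large p2_below_line_interval
          p2_above_line_interval p2_above_line_lo2 p2_below_line_hi2 p2_changes_sign; assumption)
qed

end
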